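(* Let $N\ge 1$ be an integer and let $h_0(y),\dots,h_N(y)$ be polynomials with real coefficients, $h_0(y)=1$, $\deg h_i\le \frac N2-\left|\frac N2-i\right|$, such that $h(z,y)=\sum_{i=0}^N h_i(y)z^i$ satisfies $h(z,y)\neq 0$ for all $|z|\le 1$ and all $-1\le y\le 1$. Consider the measure on $[-1,1]^2$ $$d\mu(x,y)=\frac{4}{\pi^2}\frac{\sqrt{1-x^2}\sqrt{1-y^2}}{|h(z,y)|^2}\,dx\,dy,\qquad x=\tfrac12(z+1/z),\ |z|=1,$$ and the recurrence coefficient matrices $A_{x,n},A_{y,n},B_{x,n},B_{y,n}$ of its orthonormal polynomials in the total degree ordering (see context). Then for all $n\ge\lceil\frac{N-1}{2}\rceil$: (1) $$A_{y,n}=\begin{bmatrix} C_{y,n}&0&\cdots&0&0\\ 0&1/2&&&\\ \vdots&&\ddots&&\\ 0&&&1/2&0\end{bmatrix},$$ where $C_{y,n}$ is a $\lceil\frac{N-1}{2}\rceil\times\lceil\frac{N-1}{2}\rceil$ lower triangular matrix with positive diagonal elements; (2) $$B_{y,n}=\begin{bmatrix} D_{y,n}&0\\0&0\end{bmatrix},$$ where $D_{y,n}$ is a symmetric $\lceil\frac{N-2}{2}\rceil\times\lceil\frac{N-2}{2}\rceil$ matrix; (3) $$A_{x,n}=\begin{bmatrix} C_{x,n}&0\\ 0&\frac12 I_{n-\lceil\frac{N-1}{2}\rceil}\end{bmatrix},$$ where $C_{x,n}$ is a $\lceil\frac{N+1}{2}\rceil\times\left(\lceil\frac{N+1}{2}\rceil+1\right)$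 lower Hessenberg matrix with positive entries on the upper diagonal (the $(i,i+1)$ entries), and $I_s$ is the $s\times s$ identity matrix; (4) $$B_{x,n}=\begin{bmatrix} D_{x,n}&0\\0&0\end{bmatrix},$$ where $D_{x,n}$ is a symmetric $\lceil\frac N2\rceil\times\lceil\frac N2\rceil$ matrix.
   Context: Total degree ordering: $(i,j)<_{\rm td}(i_1,j_1)$ iff $i+j<i_1+j_1$, or $i+j=i_1+j_1$ and $i<i_1$. For $0\le r\le n$, $p_n^r(x,y)$ is the unique polynomial that is a linear combination of $x^iy^j$ with $(i,j)\le_{\rm td}(r,n-r)$, has positive coefficient of $x^ry^{n-r}$, satisfies $\int (p_n^r)^2d\mu=1$, and is orthogonal with respect to $\mu$ to all $x^iy^j$ with $(i,j)<_{\rm td}(r,n-r)$. Let $\mathbf P_n=[p_n^0,p_n^1,\dots,p_n^n]^t$. The matrices are defined by the three term recurrences $$x\mathbf P_n=A_{x,n}\mathbf P_{n+1}+B_{x,n}\mathbf P_n+A_{x,n-1}^t\mathbf P_{n-1},\qquad y\mathbf P_n=A_{y,n}\mathbf P_{n+1}+B_{y,n}\mathbf P_n+A_{y,n-1}^t\mathbf P_{n-1},$$ i.e. $A_{x,n}=\int x\,\mathbf P_n\mathbf P_{n+1}^t\,d\mu$, $B_{x,n}=\int x\,\mathbf P_n\mathbf P_n^t\,d\mu$, and similarly with $y$; $A_{x,n},A_{y,n}$ are $(n+1)\times(n+2)$ and $B_{x,n},B_{y,n}$ are $(n+1)\times(n+1)$. In (1) the lower right part is the $\left(n+1-\lceil\frac{N-1}{2}\rceil\right)$-square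 matrix $\frac12 I$ followed by a final zero column; zero blocks have the sizes needed to fill the matrices, and blocks of size $0$ are absent. Lower Hessenberg means the $(i,j)$ entry vanishes for $j>i+1$. For $x=\cos\theta$ take $z=e^{i\theta}$. *)

theory Defs
  imports
    "HOL-Analysis.Analysis"
    "HOL-Computational_Algebra.Polynomial"
    "Jordan_Normal_Form.Matrix"
begin

(* A bivariate polynomial is P :: real poly poly; the outer variable is x and the inner one is y,
   so that coeff (coeff P i) j is the coefficient of x^i y^j. *)
definition eval2 :: "real poly poly \<Rightarrow> real \<Rightarrow> real \<Rightarrow> real" where
  "eval2 P x y = poly (poly P [:x:]) y"

definition td_less :: "nat \<times> nat \<Rightarrow> nat \<times> nat \<Rightarrow> bool" where
  "td_less = (\<lambda>(i, j) (i', j'). i + j < i' + j' \<or> (i + j = i' + j' \<and> i < i'))"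

definition td_le :: "nat \<times> nat \<Rightarrow> nat \<times> nat \<Rightarrow> bool" where
  "td_le a b \<longleftrightarrow> td_less a b \<or> a = b"

definition is_orthonormal_poly ::
  "(real \<times> real) measure \<Rightarrow> nat \<Rightarrow> nat \<Rightarrow> real poly poly \<Rightarrow> bool" where
  "is_orthonormal_poly \<mu> n r P \<longleftrightarrow>
     (\<forall>i j. coeff (coeff P i) j \<noteq> 0 \<longrightarrow> td_le (i, j) (r, n - r)) \<and>
     coeff (coeff P r) (n - r) > 0 \<and>
     (LINT (x, y)|\<mu>. (eval2 P x y)\<^sup>2) = 1 \<and>
     (\<forall>i j. td_less (i, j) (r, n - r) \<longrightarrow> (LINT (x, y)|\<mu>. eval2 P x y * (x ^ i * y ^ j)) = 0)"

definition orthonormal_poly :: "(real \<times> real) measure \<Rightarrow> nat \<Rightarrow> nat \<Rightarrow> real poly poly" where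
  "orthonormal_poly \<mu> n r = (THE P. is_orthonormal_poly \<mu> n r P)"

(* The matrix of the integrals of f P_n P_m^t, of size (n+1) x (m+1). *)
definition moment_mat ::
  "(real \<times> real) measure \<Rightarrow> (real \<Rightarrow> real \<Rightarrow> real) \<Rightarrow> nat \<Rightarrow> nat \<Rightarrow> real mat" where
  "moment_mat \<mu> f n m = Matrix.mat (n + 1) (m + 1)
     (\<lambda>(i, j). LINT (x, y)|\<mu>. f x y * eval2 (orthonormal_poly \<mu> n i) x y
                                  * eval2 (orthonormal_poly \<mu> m j) x y)"

definition A_x :: "(real \<times> real) measure \<Rightarrow> nat \<Rightarrow> real mat" where
  "A_x \<mu> n = moment_mat \<mu> (\<lambda>x y. x) n (n + 1)"

definition A_y :: "(real \<times> real) measure \<Rightarrow> nat \<Rightarrow> real mat" where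
  "A_y \<mu> n = moment_mat \<mu> (\<lambda>x y. y) n (n + 1)"

definition B_x :: "(real \<times> real) measure \<Rightarrow> nat \<Rightarrow> real mat" where
  "B_x \<mu> n = moment_mat \<mu> (\<lambda>x y. x) n n"

definition B_y :: "(real \<times> real) measure \<Rightarrow> nat \<Rightarrow> real mat" where
  "B_y \<mu> n = moment_mat \<mu> (\<lambda>x y. y) n n"

definition h_sum :: "nat \<Rightarrow> (nat \<Rightarrow> real poly) \<Rightarrow> complex \<Rightarrow> real \<Rightarrow> complex" where
  "h_sum N h z y = (\<Sum>i = 0..N. complex_of_real (poly (h i) y) * z ^ i)"

(* For x = cos \<theta> the point z on the unit circle is e^(i\<theta>) with \<theta> = arccos x. *)
definition bs_measure :: "nat \<Rightarrow> (nat \<Rightarrow> real poly) \<Rightarrow> (real \<times> real) measure" where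
  "bs_measure N h = density lborel (\<lambda>(x, y). ennreal
     (indicator ({-1..1} \<times> {-1..1}) (x, y) *
      (4 / pi\<^sup>2 * (sqrt (1 - x\<^sup>2) * sqrt (1 - y\<^sup>2)) / (cmod (h_sum N h (cis (arccos x)) y))\<^sup>2)))"

definition ceil_half :: "int \<Rightarrow> nat" where
  "ceil_half m = nat \<lceil>real_of_int m / 2\<rceil>"

definition lower_triangular :: "real mat \<Rightarrow> bool" where
  "lower_triangular A \<longleftrightarrow> (\<forall>i < dim_row A. \<forall>j < dim_col A. j > i \<longrightarrow> A $$ (i, j) = 0)"

definition lower_hessenberg :: "real mat \<Rightarrow> bool" where
  "lower_hessenberg A \<longleftrightarrow> (\<forall>i < dim_row A. \<forall>j < dim_col A. j > i + 1 \<longrightarrow> A $$ (i, j) = 0)"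

(* The s-square matrix (1/2) I followed by a zero column. *)
definition half_id_zero_col :: "nat \<Rightarrow> real mat" where
  "half_id_zero_col s = Matrix.mat s (s + 1) (\<lambda>(i, j). if i = j then 1/2 else 0)"

end

theory Submission
  imports Defs "HOL-Complex_Analysis.Cauchy_Integral_Theorem"
    "HOL-Computational_Algebra.Fundamental_Theorem_Algebra"
begin

text \<open>For fixed \<open>y\<close> the \<open>x\<close>-weight is a one-variable Bernstein-Szego weight, with polynomials
  \<open>q_k(x, y) = \<Sum>i. h_i(y) U_{k-i}(x)\<close>, where \<open>U_{-2-k} = - U_k\<close>. On the unit circle
  \<open>q_k sin \<theta> / |h|\<^sup>2 = Im (z^{k+1} / h)\<close>, so all moments of \<open>q_k\<close> reduce to the integrals
  \<open>J_s(y)\<close> of \<open>Re (z^s / h)\<close> over the half circle. These vanish for \<open>s > 0\<close> by Cauchy's theorem,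
  and \<open>\<Sum>i. h_i J_{s+i} = \<pi> \<delta>_{s,0}\<close> then shows that \<open>J_{-s}\<close> is a polynomial in \<open>y\<close> of degree
  at most \<open>s\<close>. Hence \<open>q_r(x, y) U_{n-r}(y)\<close> is orthogonal to every earlier monomial, and the degree
  bounds on the \<open>h_i\<close> make it a multiple of \<open>p_n^r\<close> as soon as \<open>N \<le> 2 r + 2\<close>. The nontrivial
  rows of the matrices are read off from the Chebyshev recurrence for \<open>q_r\<close> in \<open>x\<close> and for
  \<open>U_{n-r}\<close> in \<open>y\<close>; the remaining entries only use the term ordering.\<close>

section \<open>Chebyshev polynomials\<close>

text \<open>The index is shifted: \<open>chebS n\<close> is \<open>U_{n-1}\<close>, the quotient \<open>sin (n t) / sin t\<close>.\<close>

fun chebS :: "nat \<Rightarrow> 'a :: comm_ring_1 poly" where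
  "chebS 0 = 0"
| "chebS (Suc 0) = 1"
| "chebS (Suc (Suc n)) = [:0, 2:] * chebS (Suc n) - chebS n"

definition chebU :: "int \<Rightarrow> 'a :: comm_ring_1 poly" where
  "chebU k = (if k \<ge> -1 then chebS (nat (k + 1)) else - chebS (nat (- k - 1)))"

lemma chebU_minus_one [simp]: "chebU (-1) = 0"
  by (simp add: chebU_def)

lemma chebU_reflect: "chebU (- 2 - k) = - chebU k"
proof -
  consider "k = -1" | "k > -1" | "k < -1" by linarith
  then show ?thesis
  proof cases
    case 2
    then have "- (- 2 - k) - 1 = k + 1" "\<not> - 2 - k \<ge> -1" by auto
    with 2 show ?thesis by (simp add: chebU_def add.commute)
  next
    case 3
    then have "- 2 - k + 1 = - k - 1" "- 2 - k \<ge> -1" by auto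
    with 3 show ?thesis by (simp only: chebU_def) simp
  qed simp
qed

lemma chebU_rec_nonneg:
  assumes "k \<ge> 0"
  shows "[:0, 2:] * chebU k = chebU (k + 1) + chebU (k - 1)"
proof -
  define n where "n = nat k"
  have k: "k = int n" using assms by (simp add: n_def)
  have "nat (k + 1 + 1) = Suc (Suc n)" "nat (k + 1) = Suc n" "nat (k - 1 + 1) = n"
    using k by auto
  with assms show ?thesis by (simp add: chebU_def)
qed

text \<open>Below -1 the reflection turns the identity into the nonnegative case; at -1 the two
  neighbours U_0 and U_{-2} cancel.\<close>

lemma chebU_rec: "[:0, 2:] * chebU k = chebU (k + 1) + chebU (k - 1)"
proof -
  consider "k \<ge> 0" | "k = -1" | "- 2 - k \<ge> 0" by linarith
  then show ?thesis
  proof cases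
    case 1
    then show ?thesis by (rule chebU_rec_nonneg)
  next
    case 2
    then show ?thesis using chebU_reflect[of 0, where 'a = 'a] by simp
  next
    case 3
    have eq: "- 2 - k + 1 = - 2 - (k - 1)" "- 2 - k - 1 = - 2 - (k + 1)" by auto
    have "- ([:0, 2:] * chebU k) = - (chebU (k + 1) + chebU (k - 1) :: 'a poly)"
      using chebU_rec_nonneg[OF 3, where 'a = 'a] unfolding eq chebU_reflect
      by (simp add: algebra_simps)
    then show ?thesis by (simp only: neg_equal_iff_equal)
  qed
qed

lemma degree_chebS: "degree (chebS (Suc n) :: 'a :: comm_ring_1 poly) \<le> n"
proof (induction n rule: less_induct)
  case (less n)
  show ?case
  proof (cases n)
    case (Suc m)
    have 1: "degree ([:0, 2:] * chebS (Suc m) :: 'a poly) \<le> n"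
    proof -
      have "degree ([:0, 2:] * chebS (Suc m) :: 'a poly)
              \<le> degree [:0, 2 :: 'a:] + degree (chebS (Suc m) :: 'a poly)"
        by (rule degree_mult_le)
      also have "\<dots> \<le> n" using less[of m] Suc by simp
      finally show ?thesis .
    qed
    have 2: "degree (chebS m :: 'a poly) \<le> n"
    proof (cases m)
      case (Suc l)
      then show ?thesis using less[of l] \<open>n = Suc m\<close> by simp
    qed simp
    show ?thesis unfolding Suc chebS.simps
      using 1 2 Suc by (simp add: degree_diff_le)
  qed simp
qed

lemma coeff_chebS: "coeff (chebS (Suc n) :: 'a :: comm_ring_1 poly) n = 2 ^ n"
proof (induction n)
  case (Suc n)
  have "coeff (chebS n :: 'a poly) (Suc n) = 0"
  proof (cases n)
    case (Suc m)
    then show ?thesis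
      using degree_chebS[of m, where 'a = 'a] by (simp add: coeff_eq_0)
  qed simp
  with Suc show ?case by simp
qed simp

lemma degree_chebU: "degree (chebU (int n) :: 'a :: comm_ring_1 poly) \<le> n"
  using degree_chebS[of n, where 'a = 'a] by (simp add: chebU_def nat_add_distrib)

lemma coeff_chebU: "coeff (chebU (int n) :: 'a :: comm_ring_1 poly) n = 2 ^ n"
  using coeff_chebS[of n, where 'a = 'a] by (simp add: chebU_def nat_add_distrib)

lemma poly_chebS_sin: "poly (chebS n) (cos t) * sin t = sin (real n * t)"
proof (induction n rule: chebS.induct)
  case (3 n)
  have "sin (real (Suc (Suc n)) * t) + sin (real n * t) = 2 * cos t * sin (real (Suc n) * t)"
    using sin_add[of "real (Suc n) * t" t] sin_diff[of "real (Suc n) * t" t]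
    by (simp add: algebra_simps)
  with 3 show ?case by (simp add: algebra_simps)
qed simp_all

lemma poly_chebU_sin: "poly (chebU k) (cos t) * sin t = sin (real_of_int (k + 1) * t)"
proof (cases "k \<ge> -1")
  case True
  then show ?thesis by (simp add: chebU_def poly_chebS_sin)
next
  case False
  then have "real (nat (- k - 1)) * t = - (real_of_int (k + 1) * t)"
    by (simp add: algebra_simps)
  then show ?thesis using False
    by (simp add: chebU_def poly_chebS_sin del: of_int_add)
qed

text \<open>Links the copy of the polynomial over \<open>real poly\<close> with the one over
  \<open>real\<close>, as \<open>eval2\<close> substitutes a constant polynomial for x.\<close>

lemma poly_const_chebS: "poly (chebS n) [:x:] = [:poly (chebS n) x:]"
  by (induction n rule: chebS.induct) (simp_all add: numeral_poly)

lemma poly_const_chebU: "poly (chebU k) [:x:] = [:poly (chebU k) x:]"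
  by (simp add: chebU_def poly_const_chebS)

text \<open>These are the polynomials q_k of the introduction. The index is an integer so that the
  recurrence in x holds without boundary cases.\<close>

definition bs_poly :: "nat \<Rightarrow> (nat \<Rightarrow> real poly) \<Rightarrow> int \<Rightarrow> real poly poly" where
  "bs_poly N h k = (\<Sum>i = 0..N. Polynomial.smult (h i) (chebU (k - int i)))"

lemma bs_poly_rec: "[:0, 2:] * bs_poly N h k = bs_poly N h (k + 1) + bs_poly N h (k - 1)"
proof -
  have "[:0, 2:] * bs_poly N h k = (\<Sum>i = 0..N. Polynomial.smult (h i) ([:0, 2:] * chebU (k - int i)))"
    by (simp add: bs_poly_def sum_distrib_left)
  also have "\<dots> = bs_poly N h (k + 1) + bs_poly N h (k - 1)"
    unfolding chebU_rec bs_poly_def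
    by (simp add: smult_add_right sum.distrib algebra_simps)
  finally show ?thesis .
qed

lemma eval2_add [simp]: "eval2 (P + Q) x y = eval2 P x y + eval2 Q x y"
  and eval2_diff [simp]: "eval2 (P - Q) x y = eval2 P x y - eval2 Q x y"
  and eval2_minus [simp]: "eval2 (- P) x y = - eval2 P x y"
  and eval2_mult [simp]: "eval2 (P * Q) x y = eval2 P x y * eval2 Q x y"
  and eval2_smult [simp]: "eval2 (Polynomial.smult p P) x y = poly p y * eval2 P x y"
  and eval2_0 [simp]: "eval2 0 x y = 0"
  and eval2_pCons [simp]: "eval2 (pCons p P) x y = poly p y + x * eval2 P x y"
  by (simp_all add: eval2_def)

lemma eval2_sum [simp]: "eval2 (sum P S) x y = (\<Sum>s\<in>S. eval2 (P s) x y)"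
  by (simp add: eval2_def poly_sum)

lemma eval2_chebU [simp]: "eval2 (chebU k) x y = poly (chebU k) x"
  by (simp add: eval2_def poly_const_chebU)

lemma eval2_bs_poly: "eval2 (bs_poly N h k) x y = (\<Sum>i = 0..N. poly (h i) y * poly (chebU (k - int i)) x)"
  by (simp add: bs_poly_def)

section \<open>Trigonometric moments\<close>

text \<open>This locale serves the one-variable analysis in x. It admits \<open>N = 0\<close>, so
  that the Chebyshev weight is an instance; the bound by \<open>N - i\<close> joins in
  \<open>bernstein_szego_plane\<close>.\<close>

locale bernstein_szego =
  fixes N :: nat and h :: "nat \<Rightarrow> real poly"
  assumes h_0: "h 0 = 1"
    and degree_h: "\<And>i. i \<le> N \<Longrightarrow> degree (h i) \<le> i"
    and h_sum_nonzero: "\<And>(z::complex) y. cmod z \<le> 1 \<Longrightarrow> -1 \<le> y \<Longrightarrow> y \<le> 1 \<Longrightarrow> h_sum N h z y \<noteq> 0"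
begin

definition quot :: "int \<Rightarrow> real \<Rightarrow> real \<Rightarrow> complex" where
  "quot s y t = cis (real_of_int s * t) / h_sum N h (cis t) y"

definition J :: "int \<Rightarrow> real \<Rightarrow> real" where
  "J s y = integral {0..pi} (\<lambda>t. Re (quot s y t))"

lemma continuous_on_quot:
  assumes "y \<in> {-1..1}"
  shows "continuous_on S (quot s y)"
  unfolding quot_def using assms h_sum_nonzero[of "cis _" y]
  by (auto intro!: continuous_intros simp: h_sum_def cis_conv_exp)

lemma quot_uminus: "quot s y (- t) = cnj (quot s y t)"
proof -
  have "h_sum N h (cis (- t)) y = cnj (h_sum N h (cis t) y)"
    by (simp add: h_sum_def cis_cnj[symmetric] del: cis_inverse)
  then show ?thesis
    by (simp add: quot_def cis_cnj[symmetric] del: cis_inverse)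
qed

text \<open>For s > 0 the function z^(s-1) / h is continuous on the closed disc and holomorphic
  inside, so its contour integral is zero. As the h_i are real, the real part of \<open>quot\<close>
  is even in t, and the half circle carries half of the integral.\<close>

lemma J_pos:
  assumes y: "y \<in> {-1..1}" and s: "s > 0"
  shows "J s y = 0"
proof -
  define g where "g z = z ^ nat (s - 1) / h_sum N h z y" for z
  have nz: "h_sum N h z y \<noteq> 0" if "z \<in> cball 0 1" for z
    using that y h_sum_nonzero[of z y] by auto
  \<comment> \<open>The circle is parametrized over an interval symmetric about 0, ready for the
    reflection t to -t.\<close>
  have "(g has_contour_integral 0) (part_circlepath 0 1 (- pi) pi)"
  proof (rule Cauchy_theorem_convex[where S = "cball 0 1" and K = "{}"])
    show "continuous_on (cball 0 1) g"
      unfolding g_def using nz by (intro continuous_intros) (auto simp: h_sum_def intro!: continuous_intros)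
    show "g field_differentiable at x" if "x \<in> interior (cball 0 1) - {}" for x
    proof -
      have "h_sum N h x y \<noteq> 0" using that nz[of x] by auto
      moreover have "(\<lambda>z. h_sum N h z y) field_differentiable at x"
        unfolding h_sum_def by (intro derivative_intros)
      ultimately show ?thesis
        unfolding g_def by (intro derivative_intros) auto
    qed
    show "path_image (part_circlepath 0 1 (- pi) pi) \<subseteq> cball 0 1"
      using path_image_part_circlepath_subset'[of 1 0 "- pi" pi] by auto
  qed (auto simp: exp_minus simp flip: cis_conv_exp)
  then have "((\<lambda>t. g (cis t) * \<i> * cis t) has_integral 0) {- pi..pi}"
    using has_contour_integral_part_circlepath_iff[of "- pi" pi g 0 0 1] by simp
  \<comment> \<open>The factor \<open>cis t\<close> of dz raises the exponent from s - 1 to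
    s.\<close>
  moreover have "g (cis t) * \<i> * cis t = \<i> * quot s y t" for t
  proof -
    have "cis t ^ nat (s - 1) * cis t = cis (real (nat (s - 1)) * t + t)"
      by (simp only: Complex.DeMoivre cis_mult)
    also have "real (nat (s - 1)) * t + t = real_of_int s * t"
      using s by (simp add: algebra_simps)
    finally have "cis t ^ nat (s - 1) * cis t = cis (real_of_int s * t)" .
    then show ?thesis by (simp add: g_def quot_def field_simps)
  qed
  ultimately have "((\<lambda>t. \<i> * quot s y t) has_integral 0) {- pi..pi}" by simp
  then have "((\<lambda>t. Im (\<i> * quot s y t)) has_integral 0) {- pi..pi}"
    by (auto dest: has_integral_Im)
  then have 0: "integral {- pi..pi} (\<lambda>t. Re (quot s y t)) = 0"
    by (simp add: integral_unique)
  have int: "(\<lambda>t. Re (quot s y t)) integrable_on {a..b}" for a b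
    by (intro integrable_continuous_interval continuous_intros continuous_on_quot y)
  have "integral {- pi..pi} (\<lambda>t. Re (quot s y t)) =
          integral {- pi..0} (\<lambda>t. Re (quot s y t)) + J s y"
    unfolding J_def by (rule Henstock_Kurzweil_Integration.integral_combine[symmetric, OF _ _ int]) auto
  also have "integral {- pi..0} (\<lambda>t. Re (quot s y t)) =
               integral {0..pi} (\<lambda>t. Re (quot s y (- t)))"
    using Henstock_Kurzweil_Integration.integral_reflect_real
        [of pi 0 "\<lambda>t. Re (quot s y (- t))"] by simp
  also have "\<dots> = J s y" by (simp add: quot_uminus J_def)
  finally show ?thesis using 0 by simp
qed

lemma integral_cos_of_int: "integral {0..pi} (\<lambda>t. cos (real_of_int s * t)) = (if s = 0 then pi else 0)"
proof (cases "s = 0")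
  case False
  have "((\<lambda>t. cos (real_of_int s * t)) has_integral
           (sin (real_of_int s * pi) / s - sin (real_of_int s * 0) / s)) {0..pi}"
    by (rule fundamental_theorem_of_calculus)
       (use False in \<open>auto intro!: derivative_eq_intros simp: has_real_derivative_iff_has_vector_derivative[symmetric]\<close>)
  then show ?thesis using False
    by (simp add: integral_unique sin_int_times_real mult.commute)
qed simp

text \<open>Multiplying z^s / h by h leaves z^s, and the real coefficients h_i commute with taking
  real parts.\<close>

lemma J_rec:
  assumes y: "y \<in> {-1..1}"
  shows "(\<Sum>i = 0..N. poly (h i) y * J (s + int i) y) = (if s = 0 then pi else 0)"
proof -
  have "(\<Sum>i = 0..N. poly (h i) y * Re (quot (s + int i) y t)) = cos (real_of_int s * t)" for t
  proof -
    let ?H = "h_sum N h (cis t) y"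
    have "quot (s + int i) y t = cis (real_of_int s * t) * cis t ^ i / ?H" for i
      by (simp only: quot_def Complex.DeMoivre cis_mult of_int_add of_int_of_nat_eq distrib_right)
    then have "(\<Sum>i = 0..N. complex_of_real (poly (h i) y) * quot (s + int i) y t) =
            cis (real_of_int s * t) * (\<Sum>i = 0..N. complex_of_real (poly (h i) y) * cis t ^ i) / ?H"
      by (simp add: sum_distrib_left sum_divide_distrib mult_ac)
    also have "\<dots> = cis (real_of_int s * t)"
      using h_sum_nonzero[of "cis t" y] y by (simp add: h_sum_def)
    finally have "Re (\<Sum>i = 0..N. complex_of_real (poly (h i) y) * quot (s + int i) y t) =
                    cos (real_of_int s * t)" by simp
    then show ?thesis by simp
  qed
  then have "integral {0..pi} (\<lambda>t. cos (real_of_int s * t)) =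
          integral {0..pi} (\<lambda>t. \<Sum>i = 0..N. poly (h i) y * Re (quot (s + int i) y t))"
    by simp
  also have "\<dots> = (\<Sum>i = 0..N. integral {0..pi} (\<lambda>t. poly (h i) y * Re (quot (s + int i) y t)))"
    by (intro integral_sum integrable_continuous_interval continuous_intros continuous_on_quot y) auto
  also have "\<dots> = (\<Sum>i = 0..N. poly (h i) y * J (s + int i) y)"
    by (simp add: J_def)
  finally show ?thesis by (simp add: integral_cos_of_int)
qed

lemma J_zero:
  assumes "y \<in> {-1..1}"
  shows "J 0 y = pi"
proof -
  have "(\<Sum>i = 0..N. poly (h i) y * J (0 + int i) y) = (\<Sum>i \<in> {0}. poly (h i) y * J (0 + int i) y)"
    by (rule sum.mono_neutral_right) (auto simp: J_pos[OF assms])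
  then show ?thesis using J_rec[OF assms, of 0] by (simp add: h_0)
qed

text \<open>Since h_0 = 1, \<open>J_rec\<close> at s = -n can be solved for J_{-n}. Terms with i > n
  vanish by \<open>J_pos\<close>, and the others have degree at most i + (n - i).\<close>

lemma J_poly: "\<exists>A :: real poly. degree A \<le> n \<and> (\<forall>y \<in> {-1..1}. J (- int n) y = poly A y)"
proof (induction n rule: less_induct)
  case (less n)
  show ?case
  proof (cases "n = 0")
    case True
    then show ?thesis using J_zero by (intro exI[of _ "[:pi:]"]) auto
  next
    case False
    obtain A :: "nat \<Rightarrow> real poly" where
      A: "\<And>k. k < n \<Longrightarrow> degree (A k) \<le> k"
         "\<And>k y. k < n \<Longrightarrow> y \<in> {-1..1} \<Longrightarrow> J (- int k) y = poly (A k) y"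
      using less by metis
    define B where "B = - (\<Sum>i \<in> {1..min N n}. h i * A (n - i))"
    have "degree B \<le> n"
      unfolding B_def degree_minus
    proof (rule degree_sum_le)
      fix i assume i: "i \<in> {1..min N n}"
      have "degree (h i * A (n - i)) \<le> degree (h i) + degree (A (n - i))"
        by (rule degree_mult_le)
      also have "\<dots> \<le> i + (n - i)"
        using i by (intro add_mono degree_h A) auto
      finally show "degree (h i * A (n - i)) \<le> n" using i by simp
    qed simp
    moreover have "J (- int n) y = poly B y" if y: "y \<in> {-1..1}" for y
    proof -
      have "0 = (\<Sum>i = 0..N. poly (h i) y * J (- int n + int i) y)"
        using J_rec[OF y, of "- int n"] False by simp
      also have "\<dots> = J (- int n) y + (\<Sum>i \<in> {1..N}. poly (h i) y * J (- int n + int i) y)"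
        by (simp add: sum.atLeast_Suc_atMost h_0)
      also have "(\<Sum>i \<in> {1..N}. poly (h i) y * J (- int n + int i) y) =
                   (\<Sum>i \<in> {1..min N n}. poly (h i) y * J (- int n + int i) y)"
        by (rule sum.mono_neutral_right) (auto simp: J_pos[OF y])
      also have "\<dots> = (\<Sum>i \<in> {1..min N n}. poly (h i) y * poly (A (n - i)) y)"
      proof (intro sum.cong refl)
        fix i assume i: "i \<in> {1..min N n}"
        then have "- int n + int i = - int (n - i)" by auto
        moreover have "J (- int (n - i)) y = poly (A (n - i)) y" using i y by (intro A) auto
        ultimately show "poly (h i) y * J (- int n + int i) y = poly (h i) y * poly (A (n - i)) y"
          by (simp only:)
      qed
      finally show ?thesis by (simp add: B_def poly_sum)
    qed
    ultimately show ?thesis by blast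
  qed
qed

text \<open>Up to the factor 2 / pi this is the moment of q_k against x^i for fixed y, written in
  the angle t; \<open>inner_moment\<close> makes the link.\<close>

definition K :: "int \<Rightarrow> nat \<Rightarrow> real \<Rightarrow> real" where
  "K k i y = integral {0..pi} (\<lambda>t. Im (quot (k + 1) y t) * sin t * cos t ^ i)"

text \<open>For complex w, Im w sin t is half the difference of the real parts of w e^(-it) and w
  e^(it).\<close>

lemma K_0:
  assumes y: "y \<in> {-1..1}"
  shows "K k 0 y = (J k y - J (k + 2) y) / 2"
proof -
  have "Im (quot (k + 1) y t) * sin t = (Re (quot k y t) - Re (quot (k + 2) y t)) / 2" for t
  proof -
    have "quot k y t = quot (k + 1) y t * cis (- t)" "quot (k + 2) y t = quot (k + 1) y t * cis t"
      by (simp_all add: quot_def cis_mult algebra_simps del: cis_inverse)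
    then show ?thesis by (simp add: algebra_simps)
  qed
  then have "K k 0 y = integral {0..pi} (\<lambda>t. (Re (quot k y t) - Re (quot (k + 2) y t)) / 2)"
    by (simp only: K_def power_0 mult_1_right)
  also have "\<dots> = (J k y - J (k + 2) y) / 2"
    unfolding J_def
    by (subst integral_diff[symmetric])
       (auto intro!: integrable_continuous_interval continuous_intros continuous_on_quot y)
  finally show ?thesis .
qed

text \<open>A factor cos t averages the two neighbouring powers of z.\<close>

lemma K_Suc:
  assumes y: "y \<in> {-1..1}"
  shows "K k (Suc i) y = (K (k + 1) i y + K (k - 1) i y) / 2"
proof -
  have "Im (quot (k + 1) y t) * cos t = (Im (quot (k + 1 + 1) y t) + Im (quot (k - 1 + 1) y t)) / 2" for t
  proof -
    have "quot (k - 1 + 1) y t = quot (k + 1) y t * cis (- t)"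
         "quot (k + 1 + 1) y t = quot (k + 1) y t * cis t"
      by (simp_all add: quot_def cis_mult algebra_simps del: cis_inverse)
    then show ?thesis by (simp add: algebra_simps)
  qed
  then have "Im (quot (k + 1) y t) * sin t * cos t ^ Suc i =
        (Im (quot (k + 1 + 1) y t) * sin t * cos t ^ i + Im (quot (k - 1 + 1) y t) * sin t * cos t ^ i) / 2" for t
    by (simp add: algebra_simps) (metis (no_types, opaque_lifting) distrib_left mult.left_commute)
  then have "K k (Suc i) y = integral {0..pi} (\<lambda>t.
        (Im (quot (k + 1 + 1) y t) * sin t * cos t ^ i + Im (quot (k - 1 + 1) y t) * sin t * cos t ^ i) / 2)"
    by (simp only: K_def)
  also have "\<dots> = (K (k + 1) i y + K (k - 1) i y) / 2"
    unfolding K_def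
    by (subst Henstock_Kurzweil_Integration.integral_add[symmetric])
       (auto intro!: integrable_continuous_interval continuous_intros continuous_on_quot y)
  finally show ?thesis .
qed

text \<open>Each step of \<open>K_Suc\<close> lowers k by at most one, so only J_s with s > 0 are
  reached.\<close>

lemma K_less:
  assumes y: "y \<in> {-1..1}"
  shows "int i < k \<Longrightarrow> K k i y = 0"
proof (induction i arbitrary: k)
  case 0
  then show ?case by (simp add: K_0[OF y] J_pos[OF y])
next
  case (Suc i)
  then show ?case by (simp add: K_Suc[OF y])
qed

text \<open>In \<open>K_Suc\<close> the term with the larger index vanishes by
  \<open>K_less\<close>, so every step halves the value; the start is J_0 / 2.\<close>

lemma K_diag:
  assumes y: "y \<in> {-1..1}"
  shows "K (int i) i y = pi / 2 * (1 / 2) ^ i"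
proof (induction i)
  case 0
  then show ?case using J_pos[OF y, of 2] by (simp add: K_0[OF y] J_zero[OF y])
next
  case (Suc i)
  then show ?case by (simp add: K_Suc[OF y] K_less[OF y])
qed

text \<open>Unfolding \<open>K\<close> reaches only J_s with s \<ge> k - i, whose degree
  \<open>J_poly\<close> bounds. The bound \<open>d\<close> is left free because i - k may be
  negative.\<close>

lemma K_poly:
  "int d \<ge> int i - k \<Longrightarrow> \<exists>A :: real poly. degree A \<le> d \<and> (\<forall>y \<in> {-1..1}. K k i y = poly A y)"
proof (induction i arbitrary: k d)
  case 0
  have J: "\<exists>A :: real poly. degree A \<le> d \<and> (\<forall>y \<in> {-1..1}. J s y = poly A y)" if "int d \<ge> - s" for s
  proof (cases "s > 0")
    case True
    then show ?thesis by (intro exI[of _ 0]) (auto simp: J_pos)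
  next
    case False
    then have "- int (nat (- s)) = s" "nat (- s) \<le> d" using that by auto
    with J_poly[of "nat (- s)"] show ?thesis by (metis order_trans)
  qed
  obtain A B :: "real poly" where
    "degree A \<le> d" "\<forall>y \<in> {-1..1}. J k y = poly A y"
    "degree B \<le> d" "\<forall>y \<in> {-1..1}. J (k + 2) y = poly B y"
    using J[of k] J[of "k + 2"] 0 by auto
  then show ?case
    by (intro exI[of _ "Polynomial.smult (1 / 2) (A - B)"])
       (auto simp: K_0 intro!: degree_diff_le order_trans[OF degree_smult_le])
next
  case (Suc i)
  obtain A where A: "degree A \<le> d" "\<forall>y \<in> {-1..1}. K (k + 1) i y = poly A y"
    using Suc.IH[where k = "k + 1" and d = d] Suc.prems by auto
  obtain B where B: "degree B \<le> d" "\<forall>y \<in> {-1..1}. K (k - 1) i y = poly B y"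
    using Suc.IH[where k = "k - 1" and d = d] Suc.prems by auto
  show ?case using A B
    by (intro exI[of _ "Polynomial.smult (1 / 2) (A + B)"])
       (auto simp: K_Suc intro!: degree_add_le order_trans[OF degree_smult_le])
qed

end

section \<open>Orthonormal polynomials in the total degree ordering\<close>

definition td_upto :: "nat \<Rightarrow> nat \<Rightarrow> real poly poly set" where
  "td_upto r s = {P. \<forall>i j. coeff (coeff P i) j \<noteq> 0 \<longrightarrow> td_le (i, j) (r, s)}"

definition td_below :: "nat \<Rightarrow> nat \<Rightarrow> real poly poly set" where
  "td_below r s = {P. \<forall>i j. coeff (coeff P i) j \<noteq> 0 \<longrightarrow> td_less (i, j) (r, s)}"

abbreviation mono2 :: "nat \<Rightarrow> nat \<Rightarrow> real poly poly" where
  "mono2 i j \<equiv> monom (monom 1 j) i"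

lemma eval2_mono2: "eval2 (mono2 i j) x y = x ^ i * y ^ j"
  by (simp add: eval2_def poly_monom)

lemma td_upto_subset_below:
  "td_less (r, s) (r', s') \<Longrightarrow> td_upto r s \<subseteq> td_below r' s'"
  by (fastforce simp: td_upto_def td_below_def td_le_def td_less_def)

lemma diff_in_td_below:
  assumes "P \<in> td_upto r s" "Q \<in> td_upto r s" "coeff (coeff P r) s = coeff (coeff Q r) s"
  shows "P - Q \<in> td_below r s"
  unfolding td_below_def
proof (intro CollectI allI impI)
  fix i j assume nz: "coeff (coeff (P - Q) i) j \<noteq> 0"
  then have "coeff (coeff P i) j \<noteq> 0 \<or> coeff (coeff Q i) j \<noteq> 0" by auto
  then have "td_le (i, j) (r, s)" using assms(1, 2) by (auto simp: td_upto_def)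
  moreover have "(i, j) \<noteq> (r, s)" using nz assms(3) by auto
  ultimately show "td_less (i, j) (r, s)" by (auto simp: td_le_def)
qed

lemma td_upto_smult: "P \<in> td_upto r s \<Longrightarrow> Polynomial.smult [:c:] P \<in> td_upto r s"
  by (auto simp: td_upto_def)

lemma td_upto_mult_x: "P \<in> td_upto r s \<Longrightarrow> pCons 0 P \<in> td_upto (Suc r) s"
  by (auto simp: td_upto_def td_le_def td_less_def coeff_pCons split: nat.splits)

lemma td_upto_mult_y: "P \<in> td_upto r s \<Longrightarrow> Polynomial.smult [:0, 1:] P \<in> td_upto r (Suc s)"
  by (auto simp: td_upto_def td_le_def td_less_def coeff_pCons split: nat.splits)

lemma poly2_eq_sum:
  "P = (\<Sum>i\<le>degree P. \<Sum>j\<le>degree (coeff P i). Polynomial.smult [:coeff (coeff P i) j:] (mono2 i j))"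
proof -
  have "Polynomial.smult [:c:] (mono2 i j) = monom (monom c j) i" for c i j
    by (simp add: smult_monom)
  moreover have "(\<Sum>j\<le>degree p. monom (monom (coeff p j) j) i) = monom p i" for p :: "real poly" and i
  proof -
    have "(\<Sum>j\<le>degree p. monom (monom (coeff p j) j) i) = monom (\<Sum>j\<le>degree p. monom (coeff p j) j) i"
      by (simp add: poly_eq_iff coeff_sum)
    then show ?thesis by (simp add: poly_as_sum_of_monoms)
  qed
  ultimately show ?thesis by (simp add: poly_as_sum_of_monoms)
qed

text \<open>The real scalars enter as constant polynomials in y. The structure supplies spans for
  the Gram-Schmidt argument.\<close>

interpretation poly2: vector_space "\<lambda>c (P :: real poly poly). Polynomial.smult [:c:] P"
  by unfold_locales (simp_all add: smult_add_right smult_add_left[symmetric] mult.commute flip: one_pCons)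

lemma subspace_td_below: "poly2.subspace (td_below r s)"
proof (rule poly2.subspaceI)
  fix P Q assume PQ: "P \<in> td_below r s" "Q \<in> td_below r s"
  show "P + Q \<in> td_below r s"
    unfolding td_below_def
  proof (intro CollectI allI impI)
    fix i j assume "coeff (coeff (P + Q) i) j \<noteq> 0"
    then have "coeff (coeff P i) j \<noteq> 0 \<or> coeff (coeff Q i) j \<noteq> 0" by auto
    then show "td_less (i, j) (r, s)" using PQ by (auto simp: td_below_def)
  qed
qed (auto simp: td_below_def)

text \<open>Finite moments and definiteness are what existence and uniqueness of the orthonormal
  polynomials rest on; everything in this locale holds for any such measure.\<close>

locale poly_measure =
  fixes \<mu> :: "(real \<times> real) measure"
  assumes integrable_eval2: "\<And>P. integrable \<mu> (\<lambda>(x, y). eval2 P x y)"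
    and definite: "\<And>P. (LINT (x, y)|\<mu>. (eval2 P x y)\<^sup>2) = 0 \<Longrightarrow> P = 0"
begin

definition ip :: "real poly poly \<Rightarrow> real poly poly \<Rightarrow> real" where
  "ip P Q = (LINT (x, y)|\<mu>. eval2 P x y * eval2 Q x y)"

lemma ip_commute: "ip P Q = ip Q P"
  by (simp add: ip_def mult.commute)

lemma ip_add_left: "ip (P + P') Q = ip P Q + ip P' Q"
  using integrable_eval2[of "P * Q"] integrable_eval2[of "P' * Q"]
  by (simp add: ip_def case_prod_unfold algebra_simps)

lemma ip_smult_left: "ip (Polynomial.smult [:c:] P) Q = c * ip P Q"
  by (simp add: ip_def case_prod_unfold mult.assoc)

lemma ip_0_left [simp]: "ip 0 Q = 0"
  by (simp add: ip_def case_prod_unfold)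

lemma ip_diff_left: "ip (P - P') Q = ip P Q - ip P' Q"
  using ip_add_left[of "P - P'" P' Q] by simp

lemma ip_add_right: "ip P (Q + Q') = ip P Q + ip P Q'"
  and ip_diff_right: "ip P (Q - Q') = ip P Q - ip P Q'"
  and ip_smult_right: "ip P (Polynomial.smult [:c:] Q) = c * ip P Q"
  and ip_0_right [simp]: "ip P 0 = 0"
  by (simp_all add: ip_commute[of P] ip_add_left ip_diff_left ip_smult_left)

lemma ip_sum_right: "ip P (\<Sum>s\<in>S. Q s) = (\<Sum>s\<in>S. ip P (Q s))"
  by (induction S rule: infinite_finite_induct) (simp_all add: ip_add_right)

lemma ip_self_eq_0: "ip P P = 0 \<Longrightarrow> P = 0"
  by (rule definite) (simp add: ip_def power2_eq_square)

lemma ip_self_pos: "P \<noteq> 0 \<Longrightarrow> ip P P > 0"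
proof -
  assume "P \<noteq> 0"
  then have "ip P P \<noteq> 0" using ip_self_eq_0 by blast
  moreover have "ip P P \<ge> 0" by (simp add: ip_def case_prod_unfold)
  ultimately show ?thesis by simp
qed

lemma is_orthonormal_poly_iff:
  "is_orthonormal_poly \<mu> n r P \<longleftrightarrow>
     P \<in> td_upto r (n - r) \<and> coeff (coeff P r) (n - r) > 0 \<and> ip P P = 1 \<and>
     (\<forall>i j. td_less (i, j) (r, n - r) \<longrightarrow> ip P (mono2 i j) = 0)"
  by (simp add: is_orthonormal_poly_def td_upto_def ip_def eval2_mono2 power2_eq_square)

lemma ip_td_below_eq_0:
  assumes "\<And>i j. td_less (i, j) (r, s) \<Longrightarrow> ip P (mono2 i j) = 0" "Q \<in> td_below r s"
  shows "ip P Q = 0"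
proof -
  have "ip P Q = (\<Sum>i\<le>degree Q. \<Sum>j\<le>degree (coeff Q i). coeff (coeff Q i) j * ip P (mono2 i j))"
    by (subst poly2_eq_sum[of Q]) (simp only: ip_sum_right ip_smult_right)
  also have "\<dots> = 0"
    using assms by (intro sum.neutral ballI) (auto simp: td_below_def)
  finally show ?thesis .
qed

lemma ip_orthonormal_below:
  "is_orthonormal_poly \<mu> n r P \<Longrightarrow> Q \<in> td_below r (n - r) \<Longrightarrow> ip Q P = 0"
  by (metis is_orthonormal_poly_iff ip_td_below_eq_0 ip_commute)

text \<open>Subtracting the right multiple of \<open>P\<close> cancels the leading term of
  \<open>Q\<close>; the remainder is orthogonal to \<open>P\<close>, which has norm one.\<close>

lemma ip_orthonormal_upto:
  assumes P: "is_orthonormal_poly \<mu> n r P" and Q: "Q \<in> td_upto r (n - r)"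
  shows "ip Q P = coeff (coeff Q r) (n - r) / coeff (coeff P r) (n - r)"
proof -
  let ?c = "coeff (coeff Q r) (n - r) / coeff (coeff P r) (n - r)"
  have *: "P \<in> td_upto r (n - r)" "coeff (coeff P r) (n - r) > 0" "ip P P = 1"
    using P by (auto simp: is_orthonormal_poly_iff)
  then have "Q - Polynomial.smult [:?c:] P \<in> td_below r (n - r)"
    by (intro diff_in_td_below Q td_upto_smult) auto
  then have "ip (Q - Polynomial.smult [:?c:] P) P = 0" by (rule ip_orthonormal_below[OF P])
  then show ?thesis using * by (simp add: ip_diff_left ip_smult_left)
qed

text \<open>The inner product of \<open>P\<close> and \<open>Q\<close> equals both c / d and d / c,
  for the positive leading coefficients c and d. Hence c = d, the product is 1, and P - Q has norm
  zero.\<close>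

lemma is_orthonormal_poly_unique:
  assumes P: "is_orthonormal_poly \<mu> n r P" and Q: "is_orthonormal_poly \<mu> n r Q"
  shows "P = Q"
proof -
  define c d where "c = coeff (coeff P r) (n - r)" and "d = coeff (coeff Q r) (n - r)"
  have cd: "c > 0" "d > 0" and 1: "ip P P = 1" "ip Q Q = 1"
    and mem: "P \<in> td_upto r (n - r)" "Q \<in> td_upto r (n - r)"
    using P Q by (auto simp: is_orthonormal_poly_iff c_def d_def)
  have eq: "ip P Q = c / d" "ip Q P = d / c"
    using ip_orthonormal_upto[OF Q mem(1)] ip_orthonormal_upto[OF P mem(2)] by (auto simp: c_def d_def)
  then have "c / d = d / c" by (simp add: ip_commute)
  then have "c ^ 2 = d ^ 2" using cd by (simp add: field_simps power2_eq_square)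
  then have "c = d" using cd by (simp add: power2_eq_iff_nonneg)
  then have "ip (P - Q) (P - Q) = 0"
    using eq cd 1 by (simp add: ip_diff_left ip_diff_right)
  then show ?thesis using ip_self_eq_0 by force
qed

text \<open>One Gram-Schmidt step per generator: the new generator \<open>a\<close> is replaced by
  its residual \<open>b\<close>, and the component of \<open>v\<close> along \<open>b\<close> is
  added. The hypothesis is used for both \<open>a\<close> and \<open>v\<close>, so \<open>v\<close>
  is generalized.\<close>

lemma ex_projection:
  assumes "finite S"
  shows "\<exists>w \<in> poly2.span S. \<forall>s \<in> poly2.span S. ip (v - w) s = 0"
  using assms
proof (induction S arbitrary: v rule: finite_induct)
  case empty
  show ?case by (intro bexI[of _ 0]) auto
next
  case (insert a S)
  obtain wa where wa: "wa \<in> poly2.span S" "\<And>s. s \<in> poly2.span S \<Longrightarrow> ip (a - wa) s = 0"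
    using insert.IH by blast
  obtain wv where wv: "wv \<in> poly2.span S" "\<And>s. s \<in> poly2.span S \<Longrightarrow> ip (v - wv) s = 0"
    using insert.IH by blast
  define b u c where "b = a - wa" and "u = v - wv" and "c = ip u b / ip b b"
  define w where "w = wv + Polynomial.smult [:c:] b"
  have span: "s \<in> poly2.span S \<Longrightarrow> s \<in> poly2.span (insert a S)" for s
    using poly2.span_mono[of S "insert a S"] by auto
  have "b \<in> poly2.span (insert a S)"
    unfolding b_def using wa by (intro poly2.span_diff span[OF wa(1)] poly2.span_base) auto
  then have "w \<in> poly2.span (insert a S)"
    unfolding w_def by (intro poly2.span_add poly2.span_scale span[OF wv(1)])
  moreover have "ip (v - w) s = 0" if "s \<in> poly2.span (insert a S)" for s
  proof -
    obtain k where k: "s - Polynomial.smult [:k:] a \<in> poly2.span S"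
      using \<open>s \<in> poly2.span (insert a S)\<close> poly2.span_breakdown_eq by blast
    define t where "t = (s - Polynomial.smult [:k:] a) + Polynomial.smult [:k:] wa"
    have t: "t \<in> poly2.span S"
      unfolding t_def by (intro poly2.span_add poly2.span_scale k wa)
    have s: "s = Polynomial.smult [:k:] b + t"
      by (simp add: t_def b_def smult_diff_right)
    \<comment> \<open>If \<open>a\<close> already lies in the span then b = 0; division by zero
      gives c = 0 and the equation still holds.\<close>
    have "ip u b = c * ip b b"
    proof (cases "ip b b = 0")
      case True
      then have "b = 0" by (rule ip_self_eq_0)
      then show ?thesis by simp
    qed (simp add: c_def)
    moreover have "ip u t = 0" "ip b t = 0"
      using t wa wv by (auto simp: u_def b_def)
    moreover have "v - w = u - Polynomial.smult [:c:] b" by (simp add: u_def w_def)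
    ultimately show ?thesis
      by (simp only: s ip_add_right ip_diff_left ip_smult_left ip_smult_right) simp
  qed
  ultimately show ?case by blast
qed

text \<open>The leading monomial minus its projection onto the finitely many smaller ones keeps
  leading coefficient 1. It is therefore nonzero and can be normalized.\<close>

lemma ex_orthonormal_poly: "\<exists>P. is_orthonormal_poly \<mu> n r P"
proof -
  define s where "s = n - r"
  define S where "S = (\<lambda>(i, j). mono2 i j) ` {a. td_less a (r, s)}"
  have "{a. td_less a (r, s)} \<subseteq> {..r + s} \<times> {..r + s}"
    by (auto simp: td_less_def)
  then have "finite S" unfolding S_def by (intro finite_imageI) (rule finite_subset, auto)
  then obtain w where w: "w \<in> poly2.span S" "\<And>t. t \<in> poly2.span S \<Longrightarrow> ip (mono2 r s - w) t = 0"
    using ex_projection by blast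
  define Q where "Q = mono2 r s - w"
  have "S \<subseteq> td_below r s"
    by (auto simp: S_def td_below_def split: if_splits)
  then have below: "w \<in> td_below r s"
    using w(1) poly2.span_minimal[OF _ subspace_td_below] by blast
  then have "coeff (coeff w r) s = 0"
    by (auto simp: td_below_def td_less_def)
  then have 1: "coeff (coeff Q r) s = 1" by (simp add: Q_def)
  have Q: "Q \<in> td_upto r s"
    using below by (auto simp: Q_def td_upto_def td_below_def td_le_def split: if_splits)
  have pos: "ip Q Q > 0" using 1 by (intro ip_self_pos) auto
  define P where "P = Polynomial.smult [:1 / sqrt (ip Q Q):] Q"
  have "is_orthonormal_poly \<mu> n r P"
    unfolding is_orthonormal_poly_iff s_def[symmetric]
  proof (intro conjI allI impI)
    show "P \<in> td_upto r s" unfolding P_def by (rule td_upto_smult[OF Q])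
    show "coeff (coeff P r) s > 0" using pos by (simp add: P_def 1)
    show "ip P P = 1" using pos
      by (simp only: P_def ip_smult_left ip_smult_right) (simp add: field_simps)
    show "ip P (mono2 i j) = 0" if "td_less (i, j) (r, s)" for i j
    proof -
      have "mono2 i j \<in> poly2.span S"
        using that by (intro poly2.span_base) (force simp: S_def)
      then show ?thesis using w(2) by (simp add: P_def Q_def ip_smult_left)
    qed
  qed
  then show ?thesis by blast
qed

abbreviation opoly :: "nat \<Rightarrow> nat \<Rightarrow> real poly poly" where "opoly n r \<equiv> orthonormal_poly \<mu> n r"

lemma orthonormal_poly_eqI: "is_orthonormal_poly \<mu> n r P \<Longrightarrow> opoly n r = P"
  unfolding orthonormal_poly_def by (blast intro: the_equality is_orthonormal_poly_unique)

lemma is_orthonormal_opoly: "is_orthonormal_poly \<mu> n r (opoly n r)"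
  using ex_orthonormal_poly orthonormal_poly_eqI by metis

lemma opoly_upto: "opoly n r \<in> td_upto r (n - r)"
  and lead_opoly_pos: "coeff (coeff (opoly n r) r) (n - r) > 0"
  and ip_opoly_self: "ip (opoly n r) (opoly n r) = 1"
  using is_orthonormal_opoly[of n r] by (auto simp: is_orthonormal_poly_iff)

lemma ip_opoly_eq_0:
  "P \<in> td_upto r s \<Longrightarrow> td_less (r, s) (j, m - j) \<Longrightarrow> ip P (opoly m j) = 0"
  by (meson is_orthonormal_opoly ip_orthonormal_below subsetD td_upto_subset_below)

lemma ip_opoly_upto_pos:
  assumes "P \<in> td_upto j (m - j)" "coeff (coeff P j) (m - j) > 0"
  shows "ip P (opoly m j) > 0"
  using assms ip_orthonormal_upto[OF is_orthonormal_opoly] by (simp add: lead_opoly_pos)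

text \<open>The ordering is total, so for distinct indices one polynomial lies strictly below the
  other.\<close>

lemma ip_opoly_opoly:
  assumes "i \<le> n" "j \<le> m"
  shows "ip (opoly n i) (opoly m j) = (if n = m \<and> i = j then 1 else 0)"
proof -
  consider "n = m" "i = j" | "td_less (i, n - i) (j, m - j)" | "td_less (j, m - j) (i, n - i)"
    using assms by (fastforce simp: td_less_def)
  then show ?thesis
  proof cases
    case 1
    then show ?thesis by (simp add: ip_opoly_self)
  next
    case 2
    then show ?thesis using ip_opoly_eq_0[OF opoly_upto, of i n j m]
      by (auto simp: td_less_def)
  next
    case 3
    then show ?thesis using ip_opoly_eq_0[OF opoly_upto, of j m i n]
      by (auto simp: td_less_def ip_commute)
  qed
qed

section \<open>Entries of the recurrence matrices for a general measure\<close>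

definition X_entry :: "nat \<Rightarrow> nat \<Rightarrow> nat \<Rightarrow> nat \<Rightarrow> real" where
  "X_entry n i m j = ip (pCons 0 (opoly n i)) (opoly m j)"

definition Y_entry :: "nat \<Rightarrow> nat \<Rightarrow> nat \<Rightarrow> nat \<Rightarrow> real" where
  "Y_entry n i m j = ip (Polynomial.smult [:0, 1:] (opoly n i)) (opoly m j)"

lemma A_x_eq: "A_x \<mu> n = Matrix.mat (n + 1) (n + 2) (\<lambda>(i, j). X_entry n i (n + 1) j)"
  and B_x_eq: "B_x \<mu> n = Matrix.mat (n + 1) (n + 1) (\<lambda>(i, j). X_entry n i n j)"
  and A_y_eq: "A_y \<mu> n = Matrix.mat (n + 1) (n + 2) (\<lambda>(i, j). Y_entry n i (n + 1) j)"
  and B_y_eq: "B_y \<mu> n = Matrix.mat (n + 1) (n + 1) (\<lambda>(i, j). Y_entry n i n j)"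
  by (simp_all add: A_x_def B_x_def A_y_def B_y_def moment_mat_def X_entry_def Y_entry_def ip_def
      case_prod_unfold)

lemma X_entry_commute: "X_entry n i m j = X_entry m j n i"
  by (simp add: X_entry_def ip_def mult_ac)

lemma Y_entry_commute: "Y_entry n i m j = Y_entry m j n i"
  by (simp add: Y_entry_def ip_def mult_ac)

text \<open>Multiplication by x moves the leading index to (i + 1, n - i), which precedes (j, n + 1
  - j).\<close>

lemma X_entry_upper:
  assumes "i \<le> n" "j \<le> n + 1" "j > i + 1"
  shows "X_entry n i (n + 1) j = 0"
  unfolding X_entry_def
  by (rule ip_opoly_eq_0[OF td_upto_mult_x[OF opoly_upto]]) (use assms in \<open>auto simp: td_less_def\<close>)

lemma Y_entry_upper:
  assumes "i \<le> n" "j \<le> n + 1" "j > i"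
  shows "Y_entry n i (n + 1) j = 0"
  unfolding Y_entry_def
  by (rule ip_opoly_eq_0[OF td_upto_mult_y[OF opoly_upto]]) (use assms in \<open>auto simp: td_less_def\<close>)

text \<open>Here the leading indices coincide, so the entry is a quotient of positive leading
  coefficients.\<close>

lemma X_entry_pos:
  assumes "i \<le> n"
  shows "X_entry n i (n + 1) (i + 1) > 0"
  unfolding X_entry_def
  by (rule ip_opoly_upto_pos)
     (use td_upto_mult_x[OF opoly_upto[of n i]] lead_opoly_pos[of n i] in simp_all)

lemma Y_entry_pos:
  assumes "i \<le> n"
  shows "Y_entry n i (n + 1) i > 0"
  unfolding Y_entry_def
  by (rule ip_opoly_upto_pos)
     (use td_upto_mult_y[OF opoly_upto[of n i]] lead_opoly_pos[of n i] assms in \<open>simp_all add: Suc_diff_le\<close>)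

end

section \<open>Moments of the Bernstein-Szego measure\<close>

lemma continuous_on_eval2 [continuous_intros]:
  assumes "continuous_on S f" "continuous_on S g"
  shows "continuous_on S (\<lambda>z. eval2 P (f z) (g z))"
proof (induction P)
  case (pCons p P)
  then show ?case using assms by (auto intro!: continuous_intros)
qed simp

text \<open>Finiteness of roots is used twice: in y for fixed x, then for \<open>P\<close> over
  \<open>real poly\<close> at the infinitely many constants.\<close>

lemma eval2_eq_0_imp_eq_0:
  assumes "\<And>x y. x \<in> {-1<..<1} \<Longrightarrow> y \<in> {-1<..<1} \<Longrightarrow> eval2 P x y = 0"
  shows "P = 0"
proof -
  have inf: "infinite {-1<..<1 :: real}" by (simp add: infinite_Ioo)
  have "poly P [:x:] = 0" if "x \<in> {-1<..<1}" for x
  proof (rule ccontr)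
    assume "poly P [:x:] \<noteq> 0"
    then have "finite {y. poly (poly P [:x:]) y = 0}" by (rule poly_roots_finite)
    moreover have "{-1<..<1} \<subseteq> {y. poly (poly P [:x:]) y = 0}"
      using assms that by (auto simp: eval2_def)
    ultimately show False using inf finite_subset by blast
  qed
  then have "(\<lambda>x. [:x:]) ` {-1<..<1} \<subseteq> {p. poly P p = 0}" by auto
  moreover have "infinite ((\<lambda>x :: real. [:x:]) ` {-1<..<1})"
    using inf by (subst finite_image_iff) (auto simp: inj_on_def)
  ultimately show ?thesis using poly_roots_finite finite_subset by blast
qed

lemma integral_cos_substitution:
  fixes f :: "real \<Rightarrow> real"
  assumes "continuous_on {-1..1} f"
  shows "integral {-1..1} f = integral {0..pi} (\<lambda>t. sin t * f (cos t))"
proof -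
  \<comment> \<open>Cosine decreases, so \<open>{cos 0..cos pi}\<close> is empty and the rule gives
    minus the wanted integral.\<close>
  have "((\<lambda>t. (- sin t) *\<^sub>R f (cos t)) has_integral
          (integral {cos 0..cos pi} f - integral {cos pi..cos 0} f)) {0..pi}"
    by (rule has_integral_substitution_general[where s = "{}"])
       (use assms in \<open>auto intro!: derivative_eq_intros continuous_intros\<close>)
  from has_integral_neg[OF this]
  have "((\<lambda>t. sin t * f (cos t)) has_integral integral {-1..1} f) {0..pi}"
    by simp
  then show ?thesis by (rule integral_unique[symmetric])
qed

context bernstein_szego
begin

section \<open>The weight on the square and its iterated integrals\<close>

abbreviation \<mu> :: "(real \<times> real) measure" where "\<mu> \<equiv> bs_measure N h"

text \<open>The constant 4 / pi^2 is split evenly between the two variables.\<close>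

definition weight_x :: "real \<Rightarrow> real \<Rightarrow> real" where
  "weight_x y x = 2 / pi * sqrt (1 - x\<^sup>2) / (cmod (h_sum N h (cis (arccos x)) y))\<^sup>2"

definition weight :: "real \<times> real \<Rightarrow> real" where
  "weight = (\<lambda>(x, y). 2 / pi * sqrt (1 - y\<^sup>2) * weight_x y x)"

lemma continuous_on_weight_x:
  "continuous_on (cbox (-1, -1) (1, 1)) (\<lambda>z. weight_x (snd z) (fst z))"
  unfolding weight_x_def using h_sum_nonzero
  by (intro continuous_intros)
     (auto simp: h_sum_def cis_conv_exp mem_box Basis_prod_def ball_Un intro!: continuous_intros)

lemma continuous_on_weight: "continuous_on (cbox (-1, -1) (1, 1)) weight"
  unfolding weight_def case_prod_unfold
  by (intro continuous_intros continuous_on_weight_x)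

lemma weight_pos: "x \<in> {-1<..<1} \<Longrightarrow> y \<in> {-1<..<1} \<Longrightarrow> weight (x, y) > 0"
  using h_sum_nonzero[of "cis (arccos x)" y]
  by (auto simp: weight_def weight_x_def abs_square_less_1 abs_less_iff)

lemma weight_nonneg: "z \<in> cbox (-1, -1) (1, 1) \<Longrightarrow> weight z \<ge> 0"
  by (cases z) (auto simp: weight_def weight_x_def abs_square_le_1 abs_le_iff mem_box Basis_prod_def ball_Un)

lemma bs_measure_eq:
  "\<mu> = density lborel (\<lambda>z. ennreal (indicator (cbox (-1, -1) (1, 1)) z *\<^sub>R weight z))"
proof -
  have "(indicator ({-1..1} \<times> {-1..1}) (x, y) *
      (4 / pi\<^sup>2 * (sqrt (1 - x\<^sup>2) * sqrt (1 - y\<^sup>2)) / (cmod (h_sum N h (cis (arccos x)) y))\<^sup>2))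
      = indicator (cbox (-1, -1) (1, 1)) (x, y) *\<^sub>R weight (x, y)" for x y
    by (simp add: weight_def weight_x_def power2_eq_square cbox_Pair_eq mult_ac)
  then show ?thesis
    unfolding bs_measure_def by (simp only: case_prod_unfold prod.collapse)
qed

lemma borel_measurable_density:
  "(\<lambda>z. indicator (cbox (-1, -1) (1, 1)) z *\<^sub>R weight z) \<in> borel_measurable borel"
  by (intro borel_measurable_continuous_on_indicator continuous_on_weight) auto

lemma borel_measurable_eval2: "(\<lambda>(x, y). eval2 P x y) \<in> borel_measurable borel"
  unfolding case_prod_unfold
  by (intro borel_measurable_continuous_onI continuous_intros)

lemma integrable_indicator_weight:
  "integrable lborel (\<lambda>z. indicator (cbox (-1, -1) (1, 1)) z *\<^sub>R (weight z * eval2 P (fst z) (snd z)))"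
  by (intro borel_integrable_compact continuous_intros continuous_on_weight) auto

lemma integrable_bs_measure: "integrable \<mu> (\<lambda>(x, y). eval2 P x y)"
proof -
  have "integrable \<mu> (\<lambda>z. eval2 P (fst z) (snd z))"
    unfolding bs_measure_eq
    using borel_measurable_density borel_measurable_eval2[of P] integrable_indicator_weight[of P]
    by (subst integrable_density) (auto simp: weight_nonneg indicator_def case_prod_unfold mult_ac)
  then show ?thesis by (simp add: case_prod_unfold)
qed

text \<open>Fubini for a continuous integrand on the closed square. The x-integral is put inside,
  because for fixed y it is the one-variable problem already solved.\<close>

lemma integral_eval2:
  "(LINT (x, y)|\<mu>. eval2 P x y) =
     integral {-1..1} (\<lambda>y. 2 / pi * sqrt (1 - y\<^sup>2) * integral {-1..1} (\<lambda>x. weight_x y x * eval2 P x y))"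
proof -
  let ?S = "cbox (-1, -1) (1, 1) :: (real \<times> real) set"
  have cont: "continuous_on ?S (\<lambda>z. weight z * eval2 P (fst z) (snd z))"
    by (intro continuous_intros continuous_on_weight)
  have "(LINT (x, y)|\<mu>. eval2 P x y) =
          (LINT z|lborel. indicator ?S z *\<^sub>R weight z *\<^sub>R eval2 P (fst z) (snd z))"
    unfolding bs_measure_eq
    using borel_measurable_density borel_measurable_eval2[of P]
    by (subst integral_density) (auto simp: weight_nonneg indicator_def case_prod_unfold mult.assoc)
  also have "\<dots> = integral ?S (\<lambda>z. weight z * eval2 P (fst z) (snd z))"
    using set_borel_integral_eq_integral(2)[of ?S "\<lambda>z. weight z * eval2 P (fst z) (snd z)"]
      integrable_indicator_weight[of P]
    by (simp add: set_integrable_def set_lebesgue_integral_def)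
  also have "\<dots> = integral (cbox (-1) 1) (\<lambda>x. integral (cbox (-1) 1) (\<lambda>y. weight (x, y) * eval2 P x y))"
    using integral_prod_continuous[OF cont] by simp
  also have "\<dots> = integral (cbox (-1) 1) (\<lambda>y. integral (cbox (-1) 1) (\<lambda>x. weight (x, y) * eval2 P x y))"
    by (rule integral_swap_continuous) (use cont in \<open>simp add: case_prod_unfold\<close>)
  also have "\<dots> = integral {-1..1}
      (\<lambda>y. 2 / pi * sqrt (1 - y\<^sup>2) * integral {-1..1} (\<lambda>x. weight_x y x * eval2 P x y))"
    by (simp add: weight_def mult.assoc)
  finally show ?thesis .
qed

text \<open>The weight is positive on the open square, so the open set where \<open>P\<close> does
  not vanish is a null set there and hence empty.\<close>

lemma square_integral_eq_0_imp_eq_0: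
  assumes "(LINT (x, y)|\<mu>. (eval2 P x y)\<^sup>2) = 0"
  shows "P = 0"
proof -
  define U :: "(real \<times> real) set" where "U = {-1<..<1} \<times> {-1<..<1}"
  define T where "T = {z \<in> U. eval2 P (fst z) (snd z) \<noteq> 0}"
  have "open U" unfolding U_def by (intro open_Times) auto
  then have T: "open T"
    unfolding T_def Collect_conj_eq Collect_mem_eq
    by (intro open_Int open_Collect_neq continuous_intros)
  have "integrable \<mu> (\<lambda>z. (eval2 P (fst z) (snd z))\<^sup>2)"
    using integrable_bs_measure[of "P * P"] by (simp add: power2_eq_square case_prod_unfold)
  moreover have "(LINT z|\<mu>. (eval2 P (fst z) (snd z))\<^sup>2) = 0"
    using assms by (simp add: case_prod_unfold)
  ultimately have "AE z in \<mu>. (eval2 P (fst z) (snd z))\<^sup>2 = 0"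
    by (subst (asm) integral_nonneg_eq_0_iff_AE) auto
  moreover have "(\<lambda>z. ennreal (indicator (cbox (-1, -1) (1, 1)) z *\<^sub>R weight z)) \<in> borel_measurable lborel"
    using borel_measurable_density by measurable
  ultimately have ae: "AE z in lborel. 0 < ennreal (indicator (cbox (-1, -1) (1, 1)) z *\<^sub>R weight z) \<longrightarrow>
      (eval2 P (fst z) (snd z))\<^sup>2 = 0"
    unfolding bs_measure_eq by (simp only: AE_density)
  have pos: "0 < ennreal (indicator (cbox (-1, -1) (1, 1)) z *\<^sub>R weight z)" if "z \<in> U" for z
    using that weight_pos[of "fst z" "snd z"] by (cases z) (auto simp: U_def cbox_Pair_eq)
  have "AE z in lborel. z \<notin> T"
    using ae by (rule eventually_mono) (use pos in \<open>auto simp: T_def\<close>)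
  then have "T \<in> null_sets lborel"
    using T by (subst AE_iff_null_sets) auto
  then have "negligible T"
    by (simp add: negligible_iff_null_sets null_sets_completionI)
  then have "T = {}" using open_not_negligible T by blast
  then show ?thesis
    by (intro eval2_eq_0_imp_eq_0) (auto simp: T_def U_def)
qed

text \<open>With x = cos t, one sine comes from dx and one from the weight. One of them turns q_k /
  |h|^2 into the imaginary part of \<open>quot\<close>, the other is the sine in
  \<open>K\<close>.\<close>

lemma inner_moment:
  assumes y: "y \<in> {-1..1}"
  shows "integral {-1..1} (\<lambda>x. weight_x y x * (eval2 (bs_poly N h k) x y * x ^ i)) = 2 / pi * K k i y"
proof -
  have "continuous_on {-1..1} (\<lambda>x. weight_x y x)"
    by (rule continuous_on_compose2[OF continuous_on_weight_x, of _ "\<lambda>x. (x, y)", simplified])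
       (use y in \<open>auto intro!: continuous_intros simp: mem_box Basis_prod_def ball_Un\<close>)
  then have "continuous_on {-1..1} (\<lambda>x. weight_x y x * (eval2 (bs_poly N h k) x y * x ^ i))"
    by (intro continuous_intros)
  then have "integral {-1..1} (\<lambda>x. weight_x y x * (eval2 (bs_poly N h k) x y * x ^ i)) =
     integral {0..pi} (\<lambda>t. sin t * (weight_x y (cos t) * (eval2 (bs_poly N h k) (cos t) y * cos t ^ i)))"
    by (rule integral_cos_substitution)
  also have "\<dots> = integral {0..pi} (\<lambda>t. 2 / pi * (Im (quot (k + 1) y t) * sin t * cos t ^ i))"
  proof (rule Henstock_Kurzweil_Integration.integral_cong)
    fix t assume t: "t \<in> {0..pi}"
    let ?H = "h_sum N h (cis t) y"
    have "sqrt (1 - (cos t)\<^sup>2) = sin t"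
      using t by (simp add: sin_squared_eq[symmetric] sin_ge_zero)
    then have w: "weight_x y (cos t) = 2 / pi * sin t / (cmod ?H)\<^sup>2"
      using t by (simp add: weight_x_def arccos_cos)
    \<comment> \<open>Conjugation inverts z on the circle and fixes the h_i. The imaginary parts are
      then U_{k-i}(cos t) sin t, also for negative k - i.\<close>
    have "cis (real_of_int (k + 1) * t) * cnj ?H =
            (\<Sum>i = 0..N. complex_of_real (poly (h i) y) * cis (real_of_int (k - int i + 1) * t))"
    proof -
      have "cis (real_of_int (k + 1) * t) * cnj (cis t ^ i) = cis (real_of_int (k - int i + 1) * t)" for i
      proof -
        have "real_of_int (k + 1) * t + - (real i * t) = real_of_int (k - int i + 1) * t"
          by (simp add: algebra_simps)
        then show ?thesis
          by (simp only: Complex.DeMoivre cis_cnj cis_mult)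
      qed
      then show ?thesis
        by (simp add: h_sum_def sum_distrib_left mult.left_commute del: complex_cnj_power of_int_add of_int_diff)
    qed
    then have "Im (cis (real_of_int (k + 1) * t) * cnj ?H) =
        (\<Sum>i = 0..N. poly (h i) y * sin (real_of_int (k - int i + 1) * t))"
      by (simp del: of_int_add of_int_diff)
    also have "\<dots> = eval2 (bs_poly N h k) (cos t) y * sin t"
      by (simp add: eval2_bs_poly sum_distrib_right mult.assoc poly_chebU_sin del: of_int_add of_int_diff)
    finally have q: "Im (quot (k + 1) y t) = eval2 (bs_poly N h k) (cos t) y * sin t / (cmod ?H)\<^sup>2"
      unfolding quot_def by (subst complex_div_cnj) (simp add: Im_divide_of_real)
    show "sin t * (weight_x y (cos t) * (eval2 (bs_poly N h k) (cos t) y * cos t ^ i)) =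
          2 / pi * (Im (quot (k + 1) y t) * sin t * cos t ^ i)"
      unfolding w q by simp
  qed
  finally show ?thesis by (simp add: K_def)
qed

lemma integral_smult_bs_poly:
  "(LINT (x, y)|\<mu>. eval2 (Polynomial.smult p (bs_poly N h k)) x y * (x ^ i * y ^ j)) =
     integral {-1..1} (\<lambda>y. 2 / pi * sqrt (1 - y\<^sup>2) * (poly p y * y ^ j * (2 / pi * K k i y)))"
proof -
  let ?m = "monom (monom 1 j) i :: real poly poly"
  have m: "eval2 ?m x y = x ^ i * y ^ j" for x y
    by (simp add: eval2_def poly_monom)
  have "(LINT (x, y)|\<mu>. eval2 (Polynomial.smult p (bs_poly N h k)) x y * (x ^ i * y ^ j)) =
        (LINT (x, y)|\<mu>. eval2 (Polynomial.smult p (bs_poly N h k) * ?m) x y)"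
    by (simp add: m mult.assoc)
  also have "\<dots> = integral {-1..1} (\<lambda>y. 2 / pi * sqrt (1 - y\<^sup>2) *
      integral {-1..1} (\<lambda>x. weight_x y x * eval2 (Polynomial.smult p (bs_poly N h k) * ?m) x y))"
    by (rule integral_eval2)
  also have "\<dots> = integral {-1..1} (\<lambda>y. 2 / pi * sqrt (1 - y\<^sup>2) * (poly p y * y ^ j * (2 / pi * K k i y)))"
  proof (rule Henstock_Kurzweil_Integration.integral_cong)
    fix y :: real assume y: "y \<in> {-1..1}"
    have "integral {-1..1} (\<lambda>x. weight_x y x * eval2 (Polynomial.smult p (bs_poly N h k) * ?m) x y) =
          integral {-1..1} (\<lambda>x. (poly p y * y ^ j) * (weight_x y x * (eval2 (bs_poly N h k) x y * x ^ i)))"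
      by (simp add: m mult_ac)
    also have "\<dots> = poly p y * y ^ j * (2 / pi * K k i y)"
      by (simp only: integral_mult_right inner_moment[OF y])
    finally show "2 / pi * sqrt (1 - y\<^sup>2) *
          integral {-1..1} (\<lambda>x. weight_x y x * eval2 (Polynomial.smult p (bs_poly N h k) * ?m) x y) =
        2 / pi * sqrt (1 - y\<^sup>2) * (poly p y * y ^ j * (2 / pi * K k i y))"
      by simp
  qed
  finally show ?thesis .
qed

end

text \<open>For h = 1 the x-weight is the Chebyshev weight of the second kind and
  \<open>bs_poly\<close> is \<open>chebU\<close>. The results on \<open>K\<close> become
  orthogonality relations, to be applied in the variable y.\<close>

interpretation cheb: bernstein_szego 0 "\<lambda>_. 1"
  by unfold_locales (simp_all add: h_sum_def)

lemma chebU_moment: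
  assumes "j \<le> s"
  shows "integral {-1..1} (\<lambda>y. 2 / pi * sqrt (1 - y\<^sup>2) * (poly (chebU (int s)) y * y ^ j)) =
           (if j = s then (1 / 2) ^ s else 0)"
proof -
  \<comment> \<open>The argument 0 of \<open>cheb.K\<close> is an arbitrary point of [-1, 1];
    nothing depends on it.\<close>
  have "integral {-1..1} (\<lambda>y. 2 / pi * sqrt (1 - y\<^sup>2) * (poly (chebU (int s)) y * y ^ j)) =
          2 / pi * cheb.K (int s) j 0"
    using cheb.inner_moment[of 0 "int s" j]
    by (simp add: cheb.weight_x_def h_sum_def bs_poly_def)
  then show ?thesis using assms
    by (auto simp: cheb.K_diag[of 0] cheb.K_less[of 0])
qed

lemma chebU_orthogonal:
  assumes "degree p < s"
  shows "integral {-1..1} (\<lambda>y. 2 / pi * sqrt (1 - y\<^sup>2) * (poly (chebU (int s)) y * poly p y)) = 0"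
proof -
  have eq: "2 / pi * sqrt (1 - y\<^sup>2) * (poly (chebU (int s)) y * poly p y) =
      (\<Sum>j\<le>degree p. coeff p j * (2 / pi * sqrt (1 - y\<^sup>2) * (poly (chebU (int s)) y * y ^ j)))" for y
    by (subst poly_altdef) (simp add: sum_distrib_left mult_ac)
  have "integral {-1..1} (\<lambda>y. 2 / pi * sqrt (1 - y\<^sup>2) * (poly (chebU (int s)) y * poly p y)) =
      (\<Sum>j\<le>degree p. integral {-1..1} (\<lambda>y. coeff p j * (2 / pi * sqrt (1 - y\<^sup>2) * (poly (chebU (int s)) y * y ^ j))))"
    unfolding eq
    by (intro integral_sum integrable_continuous_interval continuous_intros) auto
  also have "\<dots> = 0"
    using assms by (intro sum.neutral) (auto simp: chebU_moment simp del: times_divide_eq_left)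
  finally show ?thesis .
qed

context bernstein_szego
begin

text \<open>If i < r the inner moment is zero. Otherwise the ordering forces i + j < r + s; the
  inner moment times y^j is a polynomial of degree at most j + (i - r) < s, which is orthogonal to
  U_s.\<close>

lemma bs_orthogonal:
  assumes "td_less (i, j) (r, s)"
  shows "(LINT (x, y)|\<mu>. eval2 (Polynomial.smult (chebU (int s)) (bs_poly N h (int r))) x y * (x ^ i * y ^ j)) = 0"
proof (cases "i < r")
  case True
  have "integral {-1..1} (\<lambda>y. 2 / pi * sqrt (1 - y\<^sup>2) * (poly (chebU (int s)) y * y ^ j * (2 / pi * K (int r) i y)))
      = integral {-1..1} (\<lambda>y :: real. 0 :: real)"
    using True by (intro Henstock_Kurzweil_Integration.integral_cong) (simp add: K_less)
  then show ?thesis by (simp only: integral_smult_bs_poly integral_0)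
next
  case False
  obtain A :: "real poly" where A: "degree A \<le> i - r" "\<forall>y \<in> {-1..1}. K (int r) i y = poly A y"
    using K_poly[of i "int r" "i - r"] False by auto
  define p where "p = Polynomial.smult (2 / pi) (monom 1 j * A)"
  have "degree p \<le> j + (i - r)"
    unfolding p_def
    by (intro order_trans[OF degree_smult_le] order_trans[OF degree_mult_le] add_mono A degree_monom_le)
  also have "\<dots> < s" using assms False by (auto simp: td_less_def)
  finally have p: "degree p < s" .
  have "integral {-1..1} (\<lambda>y. 2 / pi * sqrt (1 - y\<^sup>2) * (poly (chebU (int s)) y * y ^ j * (2 / pi * K (int r) i y)))
      = integral {-1..1} (\<lambda>y. 2 / pi * sqrt (1 - y\<^sup>2) * (poly (chebU (int s)) y * poly p y))"
    using A by (intro Henstock_Kurzweil_Integration.integral_cong) (simp add: p_def poly_monom)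
  then show ?thesis by (simp only: integral_smult_bs_poly chebU_orthogonal[OF p])
qed

lemma bs_moment_diag:
  "(LINT (x, y)|\<mu>. eval2 (Polynomial.smult (chebU (int s)) (bs_poly N h (int r))) x y * (x ^ r * y ^ s)) = (1 / 2) ^ (r + s)"
proof -
  have "integral {-1..1} (\<lambda>y. 2 / pi * sqrt (1 - y\<^sup>2) * (poly (chebU (int s)) y * y ^ s * (2 / pi * K (int r) r y)))
      = integral {-1..1} (\<lambda>y. (1 / 2) ^ r * (2 / pi * sqrt (1 - y\<^sup>2) * (poly (chebU (int s)) y * y ^ s)))"
    by (intro Henstock_Kurzweil_Integration.integral_cong) (simp add: K_diag)
  also have "\<dots> = (1 / 2) ^ (r + s)"
    by (simp only: integral_mult_right chebU_moment[OF order_refl] power_add if_True refl)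
  finally show ?thesis by (simp only: integral_smult_bs_poly)
qed

end

section \<open>The explicit orthonormal polynomials and the recurrence coefficients\<close>

text \<open>All roots lie outside the closed disc, and splitting one off multiplies the constant
  term by its modulus. The weak inequality starts the induction at degree 0, where equality
  holds.\<close>

lemma cmod_lead_coeff_le:
  fixes p :: "complex poly"
  assumes "\<And>z. cmod z \<le> 1 \<Longrightarrow> poly p z \<noteq> 0"
  shows "cmod (lead_coeff p) \<le> cmod (coeff p 0) \<and> (degree p > 0 \<longrightarrow> cmod (lead_coeff p) < cmod (coeff p 0))"
  using assms
proof (induction "degree p" arbitrary: p)
  case 0
  then show ?case by simp
next
  case (Suc n)
  have "\<not> constant (poly p)" using Suc(2) by (simp add: constant_degree)
  then obtain a where a: "poly p a = 0" using fundamental_theorem_of_algebra by blast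
  then obtain q where p: "p = [:-a, 1:] * q" by (metis dvdE poly_eq_0_iff_dvd)
  have a1: "cmod a > 1" using a Suc(3)[of a] by force
  have "q \<noteq> 0" using p Suc(2) by auto
  then have "degree p = Suc (degree q)" unfolding p by (subst degree_mult_eq) auto
  then have "degree q = n" using Suc(2) by simp
  moreover have q0: "poly q z \<noteq> 0" if "cmod z \<le> 1" for z
    using Suc(3)[OF that] p by auto
  ultimately have "cmod (lead_coeff q) \<le> cmod (coeff q 0)" using Suc(1) by blast
  moreover have "cmod (lead_coeff p) = cmod (lead_coeff q)" unfolding p by (subst lead_coeff_mult) simp
  moreover have "cmod (coeff q 0) > 0" using q0[of 0] by (simp add: poly_0_coeff_0)
  then have "cmod (coeff q 0) < cmod a * cmod (coeff q 0)" using a1 by simp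
  moreover have "cmod (coeff p 0) = cmod a * cmod (coeff q 0)"
    unfolding p by (simp add: norm_mult)
  ultimately have "cmod (lead_coeff p) < cmod (coeff p 0)" by linarith
  then show ?case by simp
qed

lemma degree_coeff_chebS: "degree (coeff (chebS n :: real poly poly) i) = 0"
proof (induction n arbitrary: i rule: chebS.induct)
  case (3 n)
  have "degree (coeff (chebS (Suc (Suc n)) :: real poly poly) i) \<le> 0"
    unfolding chebS.simps coeff_diff
  proof (rule degree_diff_le)
    show "degree (coeff ([:0, 2:] * chebS (Suc n) :: real poly poly) i) \<le> 0"
    proof (cases i)
      case (Suc k)
      then have "coeff ([:0, 2:] * chebS (Suc n) :: real poly poly) i = Polynomial.smult 2 (coeff (chebS (Suc n)) k)"
        by (simp add: numeral_poly)
      then show ?thesis using 3 by simp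
    qed simp
    show "degree (coeff (chebS n :: real poly poly) i) \<le> 0" using 3 by simp
  qed
  then show ?case by simp
qed (simp_all add: coeff_1)

lemma degree_coeff_chebU: "degree (coeff (chebU k :: real poly poly) i) = 0"
  by (simp add: chebU_def degree_coeff_chebS)

section \<open>Total degree bounds\<close>

definition total_degree_le :: "nat \<Rightarrow> real poly poly \<Rightarrow> bool" where
  "total_degree_le d P \<longleftrightarrow> (\<forall>i j. coeff (coeff P i) j \<noteq> 0 \<longrightarrow> i + j \<le> d)"

lemma total_degree_le_sum:
  assumes "\<And>s. s \<in> S \<Longrightarrow> total_degree_le d (P s)"
  shows "total_degree_le d (sum P S)"
  unfolding total_degree_le_def
proof (intro allI impI)
  fix i j assume "coeff (coeff (sum P S) i) j \<noteq> 0"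
  then obtain s where "s \<in> S" "coeff (coeff (P s) i) j \<noteq> 0"
    by (auto simp: coeff_sum elim: sum.not_neutral_contains_not_neutral)
  then show "i + j \<le> d" using assms by (auto simp: total_degree_le_def)
qed

lemma total_degree_le_minus [simp]: "total_degree_le d (- P) \<longleftrightarrow> total_degree_le d P"
  by (simp add: total_degree_le_def)

lemma total_degree_le_smult:
  assumes P: "total_degree_le d P" and "degree p + d \<le> e"
  shows "total_degree_le e (Polynomial.smult p P)"
  unfolding total_degree_le_def
proof (intro allI impI)
  fix i j assume "coeff (coeff (Polynomial.smult p P) i) j \<noteq> 0"
  then have nz: "coeff (p * coeff P i) j \<noteq> 0" by simp
  then have "coeff P i \<noteq> 0" by auto
  then have "i + degree (coeff P i) \<le> d" using P by (auto simp: total_degree_le_def)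
  moreover have "j \<le> degree p + degree (coeff P i)"
    using le_degree[OF nz] degree_mult_le[of p "coeff P i"] by linarith
  ultimately show "i + j \<le> e" using assms(2) by linarith
qed

lemma total_degree_le_chebU: "total_degree_le n (chebU (int n))"
  unfolding total_degree_le_def
proof (intro allI impI)
  fix i j assume nz: "coeff (coeff (chebU (int n) :: real poly poly) i) j \<noteq> 0"
  then have "coeff (chebU (int n) :: real poly poly) i \<noteq> 0" by auto
  then have "i \<le> n" using le_degree degree_chebU[of n, where 'a = "real poly"] by (meson order_trans)
  moreover have "j = 0" using le_degree[OF nz] by (simp add: degree_coeff_chebU)
  ultimately show "i + j \<le> n" by simp
qed

lemma td_uptoI_total_degree:
  assumes "total_degree_le (r + s) P" "degree P \<le> r"
  shows "P \<in> td_upto r s"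
  unfolding td_upto_def
proof (intro CollectI allI impI)
  fix i j assume nz: "coeff (coeff P i) j \<noteq> 0"
  then have "coeff P i \<noteq> 0" by auto
  then have "i \<le> r" using le_degree assms(2) order_trans by blast
  moreover have "i + j \<le> r + s" using nz assms(1) by (auto simp: total_degree_le_def)
  ultimately show "td_le (i, j) (r, s)" by (auto simp: td_le_def td_less_def)
qed

lemma total_degree_le_below:
  "total_degree_le d P \<Longrightarrow> d < r + s \<Longrightarrow> P \<in> td_below r s"
  by (force simp: td_below_def td_less_def total_degree_le_def)

text \<open>N/2 - |N/2 - i| is the minimum of i and N - i, so the degree bound of the theorem is the
  conjunction of the two integer bounds.\<close>

locale bernstein_szego_plane = bernstein_szego +
  assumes degree_h_upper: "\<And>i. i \<le> N \<Longrightarrow> degree (h i) \<le> N - i"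
    and N_pos: "N \<ge> 1"
begin

sublocale poly_measure \<mu>
  by unfold_locales (rule integrable_bs_measure, rule square_integral_eq_0_imp_eq_0)

text \<open>For i \<le> r the bound deg h_i \<le> i gives total degree r, and i = r + 1 contributes
  U_{-1} = 0. For larger i reflection gives -U_{i-r-2}, and deg h_i \<le> N - i gives total degree
  at most N - r - 2 \<le> r. Among the terms with i > 0, x^r occurs at most in the one with i = N =
  2 r + 2.\<close>

lemma bs_term:
  assumes "N \<le> 2 * r + 2" "i \<le> N"
  shows "total_degree_le r (Polynomial.smult (h i) (chebU (int r - int i))) \<and>
    degree (Polynomial.smult (h i) (chebU (int r - int i))) \<le> r \<and>
    (i \<noteq> 0 \<longrightarrow> coeff (Polynomial.smult (h i) (chebU (int r - int i))) r =
       (if i = N \<and> N = 2 * r + 2 then - (h N * 2 ^ r) else 0))"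
proof -
  consider "i \<le> r" | "i = r + 1" | "i \<ge> r + 2" by linarith
  then show ?thesis
  proof cases
    case 1
    then have eq: "int r - int i = int (r - i)" by simp
    have d: "degree (chebU (int (r - i)) :: real poly poly) \<le> r - i" by (rule degree_chebU)
    have "total_degree_le r (Polynomial.smult (h i) (chebU (int (r - i))))"
      by (rule total_degree_le_smult[OF total_degree_le_chebU])
         (use degree_h[OF assms(2)] 1 in linarith)
    moreover have "degree (Polynomial.smult (h i) (chebU (int (r - i)))) \<le> r"
      using degree_smult_le[of "h i" "chebU (int (r - i))"] d by linarith
    moreover have "coeff (chebU (int (r - i)) :: real poly poly) r = 0" if "i \<noteq> 0"
      using d that 1 by (intro coeff_eq_0) linarith
    ultimately show ?thesis using 1 unfolding eq by auto
  next
    case 2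
    then have eq: "int r - int i = -1" by simp
    show ?thesis using 2 unfolding eq by (simp add: total_degree_le_def)
  next
    case 3
    define m where "m = i - r - 2"
    have i: "i = r + 2 + m" using 3 by (simp add: m_def)
    then have eq: "int r - int i = - 2 - int m" by simp
    have d: "degree (chebU (int m) :: real poly poly) \<le> m" by (rule degree_chebU)
    have "total_degree_le r (Polynomial.smult (h i) (chebU (int m)))"
      by (rule total_degree_le_smult[OF total_degree_le_chebU])
         (use degree_h_upper[OF assms(2)] i assms in linarith)
    moreover have "degree (Polynomial.smult (h i) (chebU (int m))) \<le> r"
      using degree_smult_le[of "h i" "chebU (int m)"] d i assms by linarith
    moreover have "coeff (chebU (int m) :: real poly poly) r = (if i = N \<and> N = 2 * r + 2 then 2 ^ r else 0)"
    proof (cases "i = N \<and> N = 2 * r + 2")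
      case True
      then have "m = r" using i by auto
      then show ?thesis using True coeff_chebU[of r, where 'a = "real poly"] by simp
    next
      case False
      then have "m < r" using i assms by auto
      then show ?thesis using d False by (subst coeff_eq_0) auto
    qed
    ultimately show ?thesis using 3 unfolding eq chebU_reflect by auto
  qed
qed

lemma total_degree_le_bs_poly: "N \<le> 2 * r + 2 \<Longrightarrow> total_degree_le r (bs_poly N h (int r))"
  unfolding bs_poly_def using bs_term by (intro total_degree_le_sum) auto

lemma degree_bs_poly: "N \<le> 2 * r + 2 \<Longrightarrow> degree (bs_poly N h (int r)) \<le> r"
  unfolding bs_poly_def using bs_term by (intro degree_sum_le) auto

text \<open>For \<open>N = 2 * r + 2\<close> the last term of \<open>bs_poly\<close> is \<open>- h N\<close> times
  \<open>chebU r\<close>, by \<open>U_{-2-r} = - U_r\<close>, which alters the leading coefficient.\<close>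

definition \<kappa> :: "nat \<Rightarrow> real" where
  "\<kappa> r = 1 - (if N = 2 * r + 2 then poly (h N) 0 else 0)"

lemma h_N_const: "h N = [:poly (h N) 0:]"
proof -
  have "degree (h N) = 0" using degree_h_upper[of N] by simp
  then obtain c where "h N = [:c:]" by (rule degree_eq_zeroE)
  then show ?thesis by simp
qed

lemma coeff_bs_poly:
  assumes "N \<le> 2 * r + 2"
  shows "coeff (bs_poly N h (int r)) r = [:2 ^ r * \<kappa> r:]"
proof -
  have two: "(2 :: real poly) ^ r = [:2 ^ r:]"
    by (simp add: numeral_poly poly_const_pow)
  have "coeff (bs_poly N h (int r)) r =
      (\<Sum>i \<in> {0..N}. coeff (Polynomial.smult (h i) (chebU (int r - int i))) r)"
    by (simp add: bs_poly_def coeff_sum)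
  also have "\<dots> = coeff (Polynomial.smult (h 0) (chebU (int r))) r +
      (\<Sum>i \<in> {Suc 0..N}. coeff (Polynomial.smult (h i) (chebU (int r - int i))) r)"
    by (subst sum.atLeast_Suc_atMost) auto
  also have "(\<Sum>i \<in> {Suc 0..N}. coeff (Polynomial.smult (h i) (chebU (int r - int i))) r) =
      (\<Sum>i \<in> {Suc 0..N}. if i = N then (if N = 2 * r + 2 then - (h N * 2 ^ r) else 0) else 0)"
    using bs_term[OF assms] by (intro sum.cong) auto
  also have "\<dots> = (if N = 2 * r + 2 then - (h N * 2 ^ r) else 0)"
    using N_pos by simp
  also have "coeff (Polynomial.smult (h 0) (chebU (int r))) r = 2 ^ r"
    by (simp add: h_0 coeff_chebU)
  also have "h N * 2 ^ r = [:2 ^ r * poly (h N) 0:]"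
    by (subst h_N_const) (simp add: two)
  also have "2 ^ r + (if b then - [:2 ^ r * c:] else 0) = [:2 ^ r * (1 - (if b then c else 0)) :: real:]" for b c
    by (simp add: two algebra_simps)
  finally show ?thesis by (simp only: \<kappa>_def)
qed

lemma \<kappa>_eq_1: "N \<le> 2 * r + 1 \<Longrightarrow> \<kappa> r = 1"
  by (simp add: \<kappa>_def)

text \<open>At y = 0 the polynomial h has constant term 1 and no zero in the closed disc, so its
  coefficient of z^N has modulus below 1. Since h_N is constant, any y in [-1, 1] would
  serve.\<close>

lemma \<kappa>_pos: "\<kappa> r > 0"
proof -
  define p where "p = (\<Sum>i = 0..N. monom (complex_of_real (poly (h i) 0)) i)"
  have "poly p z \<noteq> 0" if "cmod z \<le> 1" for z
    using h_sum_nonzero[OF that, of 0] by (simp add: p_def h_sum_def poly_sum poly_monom)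
  note p = cmod_lead_coeff_le[OF this]
  have coeff: "coeff p i = (if i \<le> N then complex_of_real (poly (h i) 0) else 0)" for i
    by (simp add: p_def coeff_sum coeff_monom)
  have "\<bar>poly (h N) 0\<bar> < 1"
  proof (cases "poly (h N) 0 = 0")
    case False
    then have "degree p = N"
      by (intro antisym degree_le le_degree) (auto simp: coeff)
    then show ?thesis using p N_pos by (simp add: coeff h_0)
  qed simp
  then have "1 - (if b then poly (h N) 0 else 0) > 0" for b by (simp add: abs_less_iff)
  then show ?thesis by (simp only: \<kappa>_def)
qed

text \<open>This is q_r(x, y) U_s(y) before normalization; for \<open>N \<le> 2 * r + 2\<close> its
  squared norm is \<open>\<kappa> r\<close>.\<close>

definition bs_opoly :: "nat \<Rightarrow> nat \<Rightarrow> real poly poly" where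
  "bs_opoly r s = Polynomial.smult (chebU (int s)) (bs_poly N h (int r))"

lemma bs_opoly_upto:
  assumes "N \<le> 2 * r + 2"
  shows "bs_opoly r s \<in> td_upto r s"
proof (rule td_uptoI_total_degree)
  show "total_degree_le (r + s) (bs_opoly r s)"
    unfolding bs_opoly_def
    by (rule total_degree_le_smult[OF total_degree_le_bs_poly[OF assms]])
       (use degree_chebU[of s, where 'a = real] in simp)
  show "degree (bs_opoly r s) \<le> r"
    unfolding bs_opoly_def using degree_bs_poly[OF assms] degree_smult_le order_trans by blast
qed

lemma lead_bs_opoly:
  "N \<le> 2 * r + 2 \<Longrightarrow> coeff (coeff (bs_opoly r s) r) s = 2 ^ (r + s) * \<kappa> r"
  by (simp add: bs_opoly_def coeff_bs_poly coeff_chebU power_add)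

lemma ip_bs_opoly_mono2:
  "td_less (i, j) (r, s) \<Longrightarrow> ip (bs_opoly r s) (mono2 i j) = 0"
  "ip (bs_opoly r s) (mono2 r s) = (1 / 2) ^ (r + s)"
  unfolding ip_def bs_opoly_def eval2_mono2 by (rule bs_orthogonal bs_moment_diag; assumption?)+

text \<open>Only the leading term of the second factor contributes; its power of 2 cancels against
  the moment in \<open>ip_bs_opoly_mono2\<close>.\<close>

lemma ip_bs_opoly_self:
  assumes "N \<le> 2 * r + 2"
  shows "ip (bs_opoly r s) (bs_opoly r s) = \<kappa> r"
proof -
  let ?c = "2 ^ (r + s) * \<kappa> r"
  have "mono2 r s \<in> td_upto r s"
    by (auto simp: td_upto_def td_le_def split: if_splits)
  then have below: "bs_opoly r s - Polynomial.smult [:?c:] (mono2 r s) \<in> td_below r s"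
    by (intro diff_in_td_below bs_opoly_upto assms td_upto_smult) (simp_all add: lead_bs_opoly[OF assms])
  have "ip (bs_opoly r s) (bs_opoly r s - Polynomial.smult [:?c:] (mono2 r s)) = 0"
    by (rule ip_td_below_eq_0[OF _ below]) (rule ip_bs_opoly_mono2(1))
  then have "ip (bs_opoly r s) (bs_opoly r s) = ?c * (1 / 2) ^ (r + s)"
    by (simp only: ip_diff_right ip_smult_right ip_bs_opoly_mono2(2))
  then show ?thesis by (simp add: power_one_over)
qed

lemma opoly_eq:
  assumes "N \<le> 2 * r + 2" "r \<le> n"
  shows "opoly n r = Polynomial.smult [:1 / sqrt (\<kappa> r):] (bs_opoly r (n - r))"
proof (rule orthonormal_poly_eqI, unfold is_orthonormal_poly_iff, intro conjI allI impI)
  let ?P = "Polynomial.smult [:1 / sqrt (\<kappa> r):] (bs_opoly r (n - r))"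
  show "?P \<in> td_upto r (n - r)" by (intro td_upto_smult bs_opoly_upto assms)
  show "coeff (coeff ?P r) (n - r) > 0"
    using \<kappa>_pos[of r] by (simp add: lead_bs_opoly[OF assms(1)])
  show "ip ?P ?P = 1"
    using \<kappa>_pos[of r] by (simp only: ip_smult_left ip_smult_right ip_bs_opoly_self[OF assms(1)]) (simp add: field_simps)
  show "ip ?P (mono2 i j) = 0" if "td_less (i, j) (r, n - r)" for i j
    by (simp only: ip_smult_left ip_bs_opoly_mono2(1)[OF that] mult_zero_right)
qed

lemma ip_total_degree_eq_0:
  "total_degree_le d P \<Longrightarrow> d < m \<Longrightarrow> j \<le> m \<Longrightarrow> ip P (opoly m j) = 0"
  by (rule ip_orthonormal_below[OF is_orthonormal_opoly], rule total_degree_le_below) auto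

text \<open>The recurrence y U_s = (U_{s+1} + U_{s-1}) / 2 leaves q_i and its normalization alone,
  so y p_n^i is half of p_{n+1}^i plus \<open>R\<close>. The remainder has total degree below n,
  hence is orthogonal to row m \<ge> n.\<close>

lemma Y_entry_eq:
  assumes "N \<le> 2 * i + 2" "i \<le> n" "j \<le> m" "n \<le> m"
  shows "Y_entry n i m j = (if m = n + 1 \<and> i = j then 1 / 2 else 0)"
proof -
  let ?c = "1 / sqrt (\<kappa> i)"
  define R where "R = Polynomial.smult (Polynomial.smult (1 / 2 * ?c) (chebU (int (n - i) - 1))) (bs_poly N h (int i))"
  have cheb: "[:0, 1:] * chebU k = Polynomial.smult (1 / 2) (chebU (k + 1) + chebU (k - 1) :: real poly)" for k
    unfolding chebU_rec[symmetric] by simp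
  have "int (n + 1 - i) = int (n - i) + 1" using assms by simp
  then have "Polynomial.smult [:0, 1:] (opoly n i) = Polynomial.smult [:1 / 2:] (opoly (n + 1) i) + R"
    using cheb[of "int (n - i)"] assms
    by (simp add: opoly_eq bs_opoly_def R_def smult_add_left smult_add_right mult_ac add.commute[of 1]
        del: of_nat_diff)
  moreover have "ip R (opoly m j) = 0"
  \<comment> \<open>For i = n the remainder contains U_{-1} = 0; excluding this case also keeps the
    subtraction n - 1 exact.\<close>
  proof (cases "i = n")
    case True
    then show ?thesis by (simp add: R_def)
  next
    case False
    then have eq: "int (n - i) - 1 = int (n - i - 1)" using assms by simp
    have "total_degree_le (n - 1) R"
      unfolding R_def
      by (rule total_degree_le_smult[OF total_degree_le_bs_poly])
         (use assms False degree_smult_le[of "1 / 2 * ?c" "chebU (int (n - i - 1))"]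
            degree_chebU[of "n - i - 1", where 'a = real] in \<open>unfold eq, linarith+\<close>)
    then show ?thesis using assms False by (intro ip_total_degree_eq_0) auto
  qed
  ultimately show ?thesis using assms
    by (simp only: Y_entry_def ip_add_left ip_smult_left ip_opoly_opoly) auto
qed

text \<open>Now x q_i = (q_{i+1} + q_{i-1}) / 2 is used. The condition N \<le> 2 i is what the
  degree bound for q_{i-1} requires, and it makes both normalizing constants equal to 1.\<close>

lemma X_entry_eq:
  assumes "N \<le> 2 * i" "i \<le> n" "j \<le> m" "n \<le> m"
  shows "X_entry n i m j = (if m = n + 1 \<and> j = i + 1 then 1 / 2 else 0)"
proof -
  define R where "R = Polynomial.smult (Polynomial.smult (1 / 2) (chebU (int (n - i)))) (bs_poly N h (int i - 1))"
  have rec: "pCons 0 (bs_poly N h k) = Polynomial.smult [:1 / 2:] (bs_poly N h (k + 1) + bs_poly N h (k - 1))" for k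
    unfolding bs_poly_rec[symmetric] by (simp add: numeral_poly)
  have \<kappa>: "\<kappa> i = 1" "\<kappa> (i + 1) = 1" using assms by (auto intro!: \<kappa>_eq_1)
  have "pCons 0 (opoly n i) = Polynomial.smult (chebU (int (n - i))) (pCons 0 (bs_poly N h (int i)))"
    using assms \<kappa> by (simp add: opoly_eq bs_opoly_def one_pCons[symmetric])
  also have "\<dots> = Polynomial.smult [:1 / 2:] (opoly (n + 1) (i + 1)) + R"
    using assms \<kappa> unfolding rec
    by (simp add: opoly_eq bs_opoly_def R_def smult_add_right one_pCons[symmetric] mult_ac add.commute[of 1])
  finally have "pCons 0 (opoly n i) = Polynomial.smult [:1 / 2:] (opoly (n + 1) (i + 1)) + R" .
  moreover have "ip R (opoly m j) = 0"
  proof -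
    have i: "i \<ge> 1" using assms N_pos by simp
    then have eq: "int i - 1 = int (i - 1)" by simp
    have "total_degree_le (n - 1) R"
      unfolding R_def eq
      by (rule total_degree_le_smult[OF total_degree_le_bs_poly])
         (use assms i degree_smult_le[of "1 / 2 :: real" "chebU (int (n - i))"]
            degree_chebU[of "n - i", where 'a = real] in linarith)+
    then show ?thesis using assms i by (intro ip_total_degree_eq_0) auto
  qed
  ultimately show ?thesis using assms
    by (simp only: X_entry_def ip_add_left ip_smult_left ip_opoly_opoly) auto
qed

end

theorem theorem4p1:
  fixes N n :: nat and h :: "nat \<Rightarrow> real poly"
  assumes "N \<ge> 1"
    and "h 0 = 1"
    and "\<And>i. i \<le> N \<Longrightarrow> real (degree (h i)) \<le> real N / 2 - \<bar>real N / 2 - real i\<bar>"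
    and "\<And>(z::complex) (y::real). cmod z \<le> 1 \<Longrightarrow> -1 \<le> y \<Longrightarrow> y \<le> 1 \<Longrightarrow> h_sum N h z y \<noteq> 0"
    and "n \<ge> ceil_half (int N - 1)"
  shows
    "(\<exists>C \<in> carrier_mat (ceil_half (int N - 1)) (ceil_half (int N - 1)).
        lower_triangular C \<and> (\<forall>i < ceil_half (int N - 1). C $$ (i, i) > 0) \<and>
        A_y (bs_measure N h) n =
          four_block_mat C
            (0\<^sub>m (ceil_half (int N - 1)) (n + 2 - ceil_half (int N - 1)))
            (0\<^sub>m (n + 1 - ceil_half (int N - 1)) (ceil_half (int N - 1)))
            (half_id_zero_col (n + 1 - ceil_half (int N - 1)))) \<and>
     (\<exists>D \<in> carrier_mat (ceil_half (int N - 2)) (ceil_half (int N - 2)).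
        transpose_mat D = D \<and>
        B_y (bs_measure N h) n =
          four_block_mat D
            (0\<^sub>m (ceil_half (int N - 2)) (n + 1 - ceil_half (int N - 2)))
            (0\<^sub>m (n + 1 - ceil_half (int N - 2)) (ceil_half (int N - 2)))
            (0\<^sub>m (n + 1 - ceil_half (int N - 2)) (n + 1 - ceil_half (int N - 2)))) \<and>
     (\<exists>C \<in> carrier_mat (ceil_half (int N + 1)) (ceil_half (int N + 1) + 1).
        lower_hessenberg C \<and> (\<forall>i < ceil_half (int N + 1). C $$ (i, i + 1) > 0) \<and>
        A_x (bs_measure N h) n =
          four_block_mat C
            (0\<^sub>m (ceil_half (int N + 1)) (n - ceil_half (int N - 1)))
            (0\<^sub>m (n - ceil_half (int N - 1)) (ceil_half (int N + 1) + 1))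
            ((1/2) \<cdot>\<^sub>m 1\<^sub>m (n - ceil_half (int N - 1)))) \<and>
     (\<exists>D \<in> carrier_mat (ceil_half (int N)) (ceil_half (int N)).
        transpose_mat D = D \<and>
        B_x (bs_measure N h) n =
          four_block_mat D
            (0\<^sub>m (ceil_half (int N)) (n + 1 - ceil_half (int N)))
            (0\<^sub>m (n + 1 - ceil_half (int N)) (ceil_half (int N)))
            (0\<^sub>m (n + 1 - ceil_half (int N)) (n + 1 - ceil_half (int N))))"
proof -
  define a b c d where "a = ceil_half (int N - 1)" and "b = ceil_half (int N - 2)"
    and "c = ceil_half (int N + 1)" and "d = ceil_half (int N)"
  have ceil: "ceil_half k = m" if "(k + 1) div 2 = int m" for k m
  proof -
    have "\<lceil>real_of_int k / 2\<rceil> = (k + 1) div 2"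
      by (rule ceiling_unique) linarith+
    then show ?thesis using that by (simp add: ceil_half_def)
  qed
  have a: "a = N div 2" and b: "b = (N - 1) div 2" and c: "c = N div 2 + 1" and d: "d = (N + 1) div 2"
    unfolding a_def b_def c_def d_def using \<open>N \<ge> 1\<close> by (intro ceil; linarith)+
  \<comment> \<open>The block sizes become index ranges: \<open>hb\<close> matches the hypothesis of
    \<open>Y_entry_eq\<close> and \<open>hd\<close> that of \<open>X_entry_eq\<close>, while
    \<open>a \<le> i\<close> implies the former.\<close>
  have ha: "N \<le> 2 * i + 1 \<longleftrightarrow> a \<le> i" and hb: "N \<le> 2 * i + 2 \<longleftrightarrow> b \<le> i"
    and hd: "N \<le> 2 * i \<longleftrightarrow> d \<le> i" for i
    unfolding a b d by linarith+
  have c: "c = a + 1" by (simp add: a c)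
  have n: "a \<le> n" using assms(5) by (simp add: a_def)
  have le: "b \<le> a" "d \<le> a + 1" using ha[of a] hb[of a] hd[of "a + 1"] by auto
  interpret bernstein_szego_plane N h
  proof
    fix i assume i: "i \<le> N"
    have "real (degree (h i)) \<le> real i" "real (degree (h i)) \<le> real N - real i"
      using assms(3)[OF i] by linarith+
    then show "degree (h i) \<le> i" "degree (h i) \<le> N - i" using i by linarith+
  qed (use assms in auto)
  have Ay: "Y_entry n i (n + 1) j = (if i = j then 1 / 2 else 0)" if "i \<le> n" "j \<le> n + 1" "a \<le> i" for i j
    using Y_entry_eq[of i n j "n + 1"] that ha[of i] by simp
  \<comment> \<open>Within one degree the entries are symmetric, so the row statement also clears
    the columns.\<close>
  have By: "Y_entry n i n j = 0" if "i \<le> n" "j \<le> n" "b \<le> i \<or> b \<le> j" for i j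
    using Y_entry_eq[of i n j n] Y_entry_eq[of j n i n] that hb[of i] hb[of j] Y_entry_commute[of n i n j] by auto
  have Ax: "X_entry n i (n + 1) j = (if j = i + 1 then 1 / 2 else 0)" if "i \<le> n" "j \<le> n + 1" "c \<le> i" for i j
    using X_entry_eq[of i n j "n + 1"] that hd[of i] le c by simp
  have Bx: "X_entry n i n j = 0" if "i \<le> n" "j \<le> n" "d \<le> i \<or> d \<le> j" for i j
    using X_entry_eq[of i n j n] X_entry_eq[of j n i n] that hd[of i] hd[of j] X_entry_commute[of n i n j] by auto
  show ?thesis
    unfolding a_def[symmetric] b_def[symmetric] c_def[symmetric] d_def[symmetric]
  proof (intro conjI)
    show "\<exists>C \<in> carrier_mat a a. lower_triangular C \<and> (\<forall>i < a. C $$ (i, i) > 0) \<and>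
        A_y \<mu> n = four_block_mat C (0\<^sub>m a (n + 2 - a)) (0\<^sub>m (n + 1 - a) a) (half_id_zero_col (n + 1 - a))"
    \<comment> \<open>The witness is the corner submatrix. \<open>Y_entry_upper\<close> clears the
      block to its right, and \<open>Ay\<close> gives all rows from \<open>a\<close> on.\<close>
    proof (intro bexI[of _ "Matrix.mat a a (\<lambda>(i, j). Y_entry n i (n + 1) j)"] conjI allI impI)
      show "A_y \<mu> n = four_block_mat (Matrix.mat a a (\<lambda>(i, j). Y_entry n i (n + 1) j))
          (0\<^sub>m a (n + 2 - a)) (0\<^sub>m (n + 1 - a) a) (half_id_zero_col (n + 1 - a))"
        unfolding A_y_eq half_id_zero_col_def
        by (rule eq_matI) (use n in \<open>auto simp: Ay[simplified] Y_entry_upper[simplified]\<close>)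
    qed (use n in \<open>auto simp: lower_triangular_def Y_entry_upper[simplified] Y_entry_pos[simplified]\<close>)
    show "\<exists>D \<in> carrier_mat b b. transpose_mat D = D \<and>
        B_y \<mu> n = four_block_mat D (0\<^sub>m b (n + 1 - b)) (0\<^sub>m (n + 1 - b) b) (0\<^sub>m (n + 1 - b) (n + 1 - b))"
    proof (intro bexI[of _ "Matrix.mat b b (\<lambda>(i, j). Y_entry n i n j)"] conjI)
      show "B_y \<mu> n = four_block_mat (Matrix.mat b b (\<lambda>(i, j). Y_entry n i n j))
          (0\<^sub>m b (n + 1 - b)) (0\<^sub>m (n + 1 - b) b) (0\<^sub>m (n + 1 - b) (n + 1 - b))"
        unfolding B_y_eq by (rule eq_matI) (use n le in \<open>auto simp: By\<close>)
      show "transpose_mat (Matrix.mat b b (\<lambda>(i, j). Y_entry n i n j)) = Matrix.mat b b (\<lambda>(i, j). Y_entry n i n j)"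
        by (rule eq_matI) (auto simp: Y_entry_commute)
    qed auto
    show "\<exists>C \<in> carrier_mat c (c + 1). lower_hessenberg C \<and> (\<forall>i < c. C $$ (i, i + 1) > 0) \<and>
        A_x \<mu> n = four_block_mat C (0\<^sub>m c (n - a)) (0\<^sub>m (n - a) (c + 1)) ((1/2) \<cdot>\<^sub>m 1\<^sub>m (n - a))"
    \<comment> \<open>The extra column of the corner moves the entries j = i + 1 onto the diagonal
      of the lower right block, which has n + 1 - c = n - a rows.\<close>
    proof (intro bexI[of _ "Matrix.mat c (c + 1) (\<lambda>(i, j). X_entry n i (n + 1) j)"] conjI allI impI)
      show "A_x \<mu> n = four_block_mat (Matrix.mat c (c + 1) (\<lambda>(i, j). X_entry n i (n + 1) j))
          (0\<^sub>m c (n - a)) (0\<^sub>m (n - a) (c + 1)) ((1/2) \<cdot>\<^sub>m 1\<^sub>m (n - a))"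
        unfolding A_x_eq
        by (rule eq_matI) (use n c in \<open>auto simp: Ax[simplified] X_entry_upper[simplified]\<close>)
    qed (use n c in \<open>auto simp: lower_hessenberg_def X_entry_upper[simplified] X_entry_pos[simplified]\<close>)
    show "\<exists>D \<in> carrier_mat d d. transpose_mat D = D \<and>
        B_x \<mu> n = four_block_mat D (0\<^sub>m d (n + 1 - d)) (0\<^sub>m (n + 1 - d) d) (0\<^sub>m (n + 1 - d) (n + 1 - d))"
    proof (intro bexI[of _ "Matrix.mat d d (\<lambda>(i, j). X_entry n i n j)"] conjI)
      show "B_x \<mu> n = four_block_mat (Matrix.mat d d (\<lambda>(i, j). X_entry n i n j))
          (0\<^sub>m d (n + 1 - d)) (0\<^sub>m (n + 1 - d) d) (0\<^sub>m (n + 1 - d) (n + 1 - d))"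
        unfolding B_x_eq by (rule eq_matI) (use n le in \<open>auto simp: Bx\<close>)
      show "transpose_mat (Matrix.mat d d (\<lambda>(i, j). X_entry n i n j)) = Matrix.mat d d (\<lambda>(i, j). X_entry n i n j)"
        by (rule eq_matI) (auto simp: X_entry_commute)
    qed auto
  qed
qed

end
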